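(* Let $(X,d)$ be a locally compact metric space, let $(\Pi_\lambda)_{\lambda\in\Lambda}$ be a transversal family of maps $\Pi_\lambda\colon X\to\mathbb{R}^m$, and let $\mu$ be a finite Borel measure on $X$. Then, for every Borel set $\Sigma\subset\Lambda$, one of the following two conditions holds (not necessarily exclusively): (1) for $\mathcal{L}^l$-a.e. $\lambda\in\Sigma$, $\Pi_\lambda\colon X\to\mathbb{R}^m$ is injective on a set of full $\mu$-measure; (2) $\mathcal{L}^l(\{\lambda\in\Sigma : (\Pi_\lambda\mu)^a\neq 0\})>0$.
   Context: $\mathcal{L}^l$ is Lebesgue measure on $\mathbb{R}^l$; $\Pi_\lambda\mu(B)=\mu(\Pi_\lambda^{-1}(B))$ is the push-forward; $(\Pi_\lambda\mu)^a$ is the absolutely continuous part of $\Pi_\lambda\mu$ with respect to $\mathcal{H}^m$ on $\mathbb{R}^m$. Transversal family: let $0<m\le l$ be integers, $\Lambda\subset\mathbb{R}^l$ open and bounded, $\Pi\colon X\times\Lambda\to\mathbb{R}^m$ continuous, and $\Pi_\lambda(x):=\Pi(x,\lambda)$. The family $(\Pi_\lambda)_{\lambda\in\Lambda}$ is transversal if: (i) for every $x\in X$ the map $\lambda\mapsto\Pi_\lambda(x)$ is in $C^2(\Lambda;\mathbb{R}^m)$ and $\sup_{(\lambda,x)\in\Lambda\times X}\|D^j_\lambda\Pi_\lambda(x)\|<\infty$ for $j=1,2$; (ii) setting $T_{xx'}(\lambda):=\frac{\Pi_\lambda(x)-\Pi_\lambda(x')}{d(x,x')}$ for $x\ne x'$,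 there is a constant $C'>0$ such that, for all $\lambda\in\Lambda$ and $x\neq x'$, $|T_{xx'}(\lambda)|\le C'$ implies $|J_\lambda T_{xx'}(\lambda)|\ge C'$, where $J_\lambda T=\sqrt{\det(D_\lambda T\,(D_\lambda T)^{t})}$ is the $m$-dimensional Jacobian; (iii) there is a constant $C''>0$ such that $\|D_\lambda T_{xx'}(\lambda)\|,\|D^2_\lambda T_{xx'}(\lambda)\|\le C''$ for all $\lambda\in\Lambda$ and $x\ne x'$. *)

theory Defs
  imports "HOL-Analysis.Analysis"
begin

section \<open>Hausdorff measure\<close>

text \<open>
  The normalisation \<open>unit_ball_vol m / 2 ^ m\<close> is the one for which the \<open>m\<close>-dimensional Hausdorff
  measure on \<open>m\<close>-dimensional Euclidean space agrees with Lebesgue measure. The library's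
  \<^const>\<open>diameter\<close> is only meaningful on bounded sets, so the covers are required to be bounded.
\<close>

definition hausdorff_weight :: "nat \<Rightarrow> 'a::metric_space set \<Rightarrow> ennreal" where
  "hausdorff_weight m C =
     (if C = {} then 0 else ennreal (unit_ball_vol (real m) * (diameter C / 2) ^ m))"

definition hausdorff_covers :: "real \<Rightarrow> 'a::metric_space set \<Rightarrow> (nat \<Rightarrow> 'a set) set" where
  "hausdorff_covers \<delta> A = {C. A \<subseteq> (\<Union>n. C n) \<and> (\<forall>n. bounded (C n) \<and> diameter (C n) \<le> \<delta>)}"

definition hausdorff_pre :: "nat \<Rightarrow> real \<Rightarrow> 'a::metric_space set \<Rightarrow> ennreal" where
  "hausdorff_pre m \<delta> A = (INF C\<in>hausdorff_covers \<delta> A. \<Sum>n. hausdorff_weight m (C n))"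

definition hausdorff_outer :: "nat \<Rightarrow> 'a::metric_space set \<Rightarrow> ennreal" where
  "hausdorff_outer m A = (SUP \<delta>\<in>{0<..}. hausdorff_pre m \<delta> A)"

definition hausdorff_measure :: "nat \<Rightarrow> 'a::metric_space measure" where
  "hausdorff_measure m = measure_of UNIV (sets borel) (hausdorff_outer m)"

text \<open>
  \<^const>\<open>measure_of\<close> yields the intended values only for a countably additive set function. The
  following lemmas establish this, ending in \<open>emeasure_hausdorff_measure\<close>.
\<close>

lemma space_hausdorff_measure [simp]: "space (hausdorff_measure m) = UNIV"
  by (simp add: hausdorff_measure_def)

lemma sets_hausdorff_measure [simp, measurable_cong]: "sets (hausdorff_measure m) = sets borel"
  by (simp add: hausdorff_measure_def) (metis sets.sigma_sets_eq space_borel)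

lemma hausdorff_weight_empty [simp]: "hausdorff_weight m {} = 0"
  by (simp add: hausdorff_weight_def)

lemma hausdorff_pre_antimono: "d \<le> e \<Longrightarrow> hausdorff_pre m e A \<le> hausdorff_pre m d A"
  unfolding hausdorff_pre_def
  by (rule INF_superset_mono) (auto simp: hausdorff_covers_def intro: order_trans)

lemma hausdorff_pre_mono: "A \<subseteq> B \<Longrightarrow> hausdorff_pre m d A \<le> hausdorff_pre m d B"
  unfolding hausdorff_pre_def
  by (rule INF_superset_mono) (auto simp: hausdorff_covers_def)

lemma hausdorff_outer_mono: "A \<subseteq> B \<Longrightarrow> hausdorff_outer m A \<le> hausdorff_outer m B"
  unfolding hausdorff_outer_def by (intro SUP_mono' hausdorff_pre_mono)

lemma hausdorff_outer_empty [simp]: "hausdorff_outer m ({} :: 'a::metric_space set) = 0"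
proof -
  have "hausdorff_pre m d ({} :: 'a set) = 0" if "0 < d" for d
  proof -
    have "hausdorff_pre m d ({} :: 'a set) \<le> (\<Sum>n. hausdorff_weight m ((\<lambda>_. {}) n))"
      unfolding hausdorff_pre_def using that
      by (intro INF_lower2[where i="\<lambda>_. {}"]) (auto simp: hausdorff_covers_def)
    then show ?thesis by simp
  qed
  then have "hausdorff_outer m ({} :: 'a set) \<le> 0"
    unfolding hausdorff_outer_def by (intro SUP_least) simp
  then show ?thesis by simp
qed

lemma hausdorff_pre_UN_le:
  "hausdorff_pre m d (\<Union>i::nat. A i) \<le> (\<Sum>i. hausdorff_pre m d (A i))"
proof (rule ennreal_le_epsilon)
  fix e :: real
  assume e: "0 < e" and fin: "(\<Sum>i. hausdorff_pre m d (A i)) < top"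
  have "\<exists>C. C \<in> hausdorff_covers d (A n) \<and>
      (\<Sum>i. hausdorff_weight m (C i)) \<le> hausdorff_pre m d (A n) + e * (1/2)^Suc n" for n
  proof -
    have "hausdorff_pre m d (A n) < hausdorff_pre m d (A n) + e * (1/2)^Suc n"
      using e fin by (auto simp add: less_top dest!: ennreal_suminf_lessD)
    then have "(INF C\<in>hausdorff_covers d (A n). \<Sum>i. hausdorff_weight m (C i))
        < hausdorff_pre m d (A n) + e * (1/2)^Suc n"
      by (simp add: hausdorff_pre_def)
    then show ?thesis
      unfolding INF_less_iff by (auto intro: less_imp_le)
  qed
  then obtain B where B: "\<And>n. B n \<in> hausdorff_covers d (A n)"
    and Ble: "\<And>n. (\<Sum>i. hausdorff_weight m (B n i)) \<le> hausdorff_pre m d (A n) + e * (1/2)^Suc n"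
    by metis
  define C where "C = case_prod B o prod_decode"
  have C: "C \<in> hausdorff_covers d (\<Union>i. A i)"
  proof -
    have "x \<in> (\<Union>n. C n)" if x: "x \<in> A i" for x i
    proof -
      obtain j where "x \<in> B i j"
        using B[of i] x unfolding hausdorff_covers_def by blast
      then have "x \<in> C (prod_encode (i, j))"
        by (simp add: C_def)
      then show ?thesis by blast
    qed
    moreover have "bounded (C n) \<and> diameter (C n) \<le> d" for n
      using B by (auto simp: C_def hausdorff_covers_def split: prod.split)
    ultimately show ?thesis
      by (auto simp: hausdorff_covers_def)
  qed
  have "hausdorff_pre m d (\<Union>i. A i) \<le> (\<Sum>i. hausdorff_weight m (C i))"
    unfolding hausdorff_pre_def by (rule INF_lower) (rule C)
  also have "\<dots> = (\<Sum>n. \<Sum>i. hausdorff_weight m (B n i))"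
    unfolding C_def comp_def by (intro suminf_ennreal_2dimen) (auto simp: split_def)
  also have "\<dots> \<le> (\<Sum>n. hausdorff_pre m d (A n) + e * (1/2) ^ Suc n)"
    by (intro suminf_le Ble) auto
  also have "... = (\<Sum>n. hausdorff_pre m d (A n)) + (\<Sum>n. ennreal e * ennreal ((1/2) ^ Suc n))"
    using e by (subst suminf_add[symmetric])
               (auto simp del: ennreal_suminf_cmult simp add: ennreal_mult[symmetric])
  also have "\<dots> = (\<Sum>n. hausdorff_pre m d (A n)) + e"
    unfolding ennreal_suminf_cmult
    by (subst suminf_ennreal_eq[OF zero_le_power power_half_series]) auto
  finally show "hausdorff_pre m d (\<Union>i. A i) \<le> (\<Sum>i. hausdorff_pre m d (A i)) + e" .
qed

lemma hausdorff_outer_UN_le: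
  "hausdorff_outer m (\<Union>i::nat. A i) \<le> (\<Sum>i. hausdorff_outer m (A i))"
  unfolding hausdorff_outer_def[of m "\<Union>i. A i"]
proof (rule SUP_least)
  fix d :: real assume "d \<in> {0<..}"
  then have "hausdorff_pre m d (A i) \<le> hausdorff_outer m (A i)" for i
    unfolding hausdorff_outer_def by (rule SUP_upper)
  then show "hausdorff_pre m d (\<Union>i. A i) \<le> (\<Sum>i. hausdorff_outer m (A i))"
    by (intro order_trans[OF hausdorff_pre_UN_le] suminf_le) auto
qed

lemma outer_measure_space_hausdorff: "outer_measure_space UNIV (hausdorff_outer m)"
  by (auto simp: outer_measure_space_def positive_def increasing_def countably_subadditive_def
      intro: hausdorff_outer_mono hausdorff_outer_UN_le)

lemma hausdorff_outer_Un_le: "hausdorff_outer m (A \<union> B) \<le> hausdorff_outer m A + hausdorff_outer m B"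
proof -
  have "hausdorff_outer m (\<Union>i. binaryset A B i) \<le> (\<Sum>i. hausdorff_outer m (binaryset A B i))"
    by (rule hausdorff_outer_UN_le)
  then show ?thesis
    by (simp add: UN_binaryset_eq suminf_binaryset_eq)
qed

lemma hausdorff_pre_separated:
  assumes r: "0 < r" "d < r" and sep: "\<And>a b. a \<in> A \<Longrightarrow> b \<in> B \<Longrightarrow> r \<le> dist a b"
  shows "hausdorff_pre m d A + hausdorff_pre m d B \<le> hausdorff_pre m d (A \<union> B)"
  unfolding hausdorff_pre_def[of m d "A \<union> B"]
proof (rule INF_greatest)
  fix C assume C: "C \<in> hausdorff_covers d (A \<union> B)"
  define CA where "CA n = (if C n \<inter> A = {} then {} else C n)" for n
  define CB where "CB n = (if C n \<inter> B = {} then {} else C n)" for n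
  have Cn: "bounded (C n)" "diameter (C n) \<le> d" for n
    using C by (simp_all add: hausdorff_covers_def)
  have sub: "A \<subseteq> (\<Union>n. C n)" "B \<subseteq> (\<Union>n. C n)"
    using C by (simp_all add: hausdorff_covers_def)
  have d: "0 \<le> d"
    using diameter_ge_0[OF Cn(1)] Cn(2) by (rule order_trans)
  have cov: "CA \<in> hausdorff_covers d A" "CB \<in> hausdorff_covers d B"
    using sub Cn d by (fastforce simp: hausdorff_covers_def CA_def CB_def)+
  have CAB: "CA n = {} \<or> CB n = {}" for n
  proof (rule ccontr)
    assume "\<not> ?thesis"
    then obtain a b where "a \<in> A" "b \<in> B" and ab: "a \<in> C n" "b \<in> C n"
      by (auto simp: CA_def CB_def split: if_splits)
    then have "r \<le> dist a b" by (intro sep)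
    moreover have "dist a b \<le> d"
      using diameter_bounded_bound[OF Cn(1) ab] Cn(2) by (rule order_trans)
    ultimately show False using r by simp
  qed
  have le: "hausdorff_weight m (CA n) + hausdorff_weight m (CB n) \<le> hausdorff_weight m (C n)" for n
    using CAB[of n] by (auto simp: CA_def CB_def split: if_splits)
  have "hausdorff_pre m d A + hausdorff_pre m d B
      \<le> (\<Sum>n. hausdorff_weight m (CA n)) + (\<Sum>n. hausdorff_weight m (CB n))"
    unfolding hausdorff_pre_def by (intro add_mono INF_lower cov)
  also have "\<dots> = (\<Sum>n. hausdorff_weight m (CA n) + hausdorff_weight m (CB n))"
    by (rule suminf_add) auto
  also have "\<dots> \<le> (\<Sum>n. hausdorff_weight m (C n))"
    by (intro suminf_le le) auto
  finally show "hausdorff_pre m d A + hausdorff_pre m d B \<le> (\<Sum>n. hausdorff_weight m (C n))" .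
qed

lemma hausdorff_outer_separated:
  assumes r: "0 < r" and sep: "\<And>a b. a \<in> A \<Longrightarrow> b \<in> B \<Longrightarrow> r \<le> dist a b"
  shows "hausdorff_outer m A + hausdorff_outer m B \<le> hausdorff_outer m (A \<union> B)"
proof -
  have *: "hausdorff_pre m d A + hausdorff_pre m e B \<le> hausdorff_outer m (A \<union> B)"
    if "0 < d" "0 < e" for d e
  proof -
    define c where "c = min (min d e) (r / 2)"
    have c: "0 < c" "c \<le> d" "c \<le> e" "c < r" using that r by (auto simp: c_def)
    have "hausdorff_pre m d A + hausdorff_pre m e B \<le> hausdorff_pre m c A + hausdorff_pre m c B"
      by (intro add_mono hausdorff_pre_antimono c)
    also have "\<dots> \<le> hausdorff_pre m c (A \<union> B)"
      by (rule hausdorff_pre_separated[OF r c(4) sep])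
    also have "\<dots> \<le> hausdorff_outer m (A \<union> B)"
      unfolding hausdorff_outer_def using c by (intro SUP_upper) simp
    finally show ?thesis .
  qed
  have ne: "{0<..} \<noteq> ({} :: real set)" by (metis empty_iff greaterThan_iff zero_less_one)
  have "hausdorff_pre m d A + hausdorff_outer m B \<le> hausdorff_outer m (A \<union> B)" if "0 < d" for d
    unfolding hausdorff_outer_def[of m B] ennreal_SUP_add_right[OF ne]
    using * that by (intro SUP_least) auto
  then show ?thesis
    unfolding hausdorff_outer_def[of m A] ennreal_SUP_add_left[OF ne, symmetric]
    by (intro SUP_least) auto
qed

lemma closed_in_lambda_system_hausdorff:
  fixes F :: "'a::metric_space set"
  assumes "closed F"
  shows "F \<in> lambda_system UNIV UNIV (hausdorff_outer m)"
proof -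
  let ?H = "hausdorff_outer m :: 'a set \<Rightarrow> ennreal"
  have "?H (X \<inter> F) + ?H (X - F) \<le> ?H X" for X
  proof (cases "?H X = top \<or> F = {}")
    case True
    then show ?thesis by auto
  next
    case False
    then have fin: "?H X \<noteq> top" and ne: "F \<noteq> {}" by auto
    define h where "h x = infdist x F" for x
    have h_dist: "h x \<le> h y + dist x y" for x y
      unfolding h_def by (rule infdist_triangle)
    define A where "A n = {x\<in>X. 1 / (real n + 1) \<le> h x}" for n
    define R where "R k = {x\<in>X. 1 / (real k + 2) \<le> h x \<and> h x < 1 / (real k + 1)}" for k
    define S where "S = (\<Sum>k. ?H (R k))"
    have alt: "(\<Sum>j<N. ?H (R (2 * j + e))) \<le> ?H (\<Union>j<N. R (2 * j + e))" for N e
    proof (induction N)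
      case (Suc N)
      define q where "q = real (2 * N + e)"
      have "?H (\<Union>j<N. R (2 * j + e)) + ?H (R (2 * N + e))
          \<le> ?H ((\<Union>j<N. R (2 * j + e)) \<union> R (2 * N + e))"
      proof (cases "N = 0")
        case False
        then have q: "q > 0" by (simp add: q_def)
        show ?thesis
        proof (rule hausdorff_outer_separated[where r = "1 / q - 1 / (q + 1)"])
          show "0 < 1 / q - 1 / (q + 1)" using q by (simp add: frac_less2)
          fix a b assume a: "a \<in> (\<Union>j<N. R (2 * j + e))" and b: "b \<in> R (2 * N + e)"
          from a obtain j where j: "j < N" "a \<in> R (2 * j + e)" by auto
          have "1 / q \<le> 1 / (real (2 * j + e) + 2)"
            using j(1) by (intro divide_left_mono) (auto simp: q_def)
          also have "\<dots> \<le> h a" using j by (simp add: R_def)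
          finally have "1 / q \<le> h a" .
          moreover have "h b < 1 / (q + 1)" using b by (simp add: R_def q_def)
          ultimately show "1 / q - 1 / (q + 1) \<le> dist a b"
            using h_dist[of a b] by linarith
        qed
      qed simp
      then have "(\<Sum>j<N. ?H (R (2 * j + e))) + ?H (R (2 * N + e))
          \<le> ?H ((\<Union>j<N. R (2 * j + e)) \<union> R (2 * N + e))"
        by (rule order_trans[OF add_right_mono[OF Suc.IH]])
      then show ?case
        by (simp add: lessThan_Suc ac_simps Un_commute)
    qed simp
    have alt_le: "(\<Sum>j<N. ?H (R (2 * j + e))) \<le> ?H X" for N e
      by (rule order_trans[OF alt]) (auto simp: R_def intro!: hausdorff_outer_mono)
    have "(\<Sum>k<N. ?H (R k)) \<le> ?H X + ?H X" for N
    proof -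
      have "(\<Sum>k<N. ?H (R k)) \<le> (\<Sum>k<2 * N. ?H (R k))"
        by (rule sum_mono2) auto
      also have "\<dots> = (\<Sum>j<N. ?H (R (2 * j + 0))) + (\<Sum>j<N. ?H (R (2 * j + 1)))"
        by (induction N) (simp_all add: ac_simps)
      also have "\<dots> \<le> ?H X + ?H X"
        by (intro add_mono alt_le)
      finally show ?thesis .
    qed
    then have "S \<le> ?H X + ?H X"
      unfolding S_def by (intro suminf_le_const) auto
    then have S: "S \<noteq> top"
      using fin by (auto simp: top_unique)
    have "(\<Sum>k<n. ?H (R k)) + (?H (X \<inter> F) + ?H (X - F)) \<le> ?H X + S" for n
    proof -
      have cov: "X - F \<subseteq> A n \<union> (\<Union>k. R (k + n))"
      proof
        fix x assume x: "x \<in> X - F"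
        then have hx: "0 < h x"
          unfolding h_def using assms ne infdist_pos_not_in_closed by auto
        show "x \<in> A n \<union> (\<Union>k. R (k + n))"
        proof (cases "x \<in> A n")
          case False
          then have lt: "h x < 1 / (real n + 1)" using x by (auto simp: A_def)
          define k where "k = (LEAST k. 1 / (real k + 2) \<le> h x)"
          obtain k0 where "1 / (real k0 + 1) < h x"
            using hx nat_approx_posE by (metis of_nat_Suc add.commute)
          then have "1 / (real k0 + 2) \<le> h x"
            by (smt (verit) frac_le of_nat_0_le_iff)
          then have k: "1 / (real k + 2) \<le> h x"
            unfolding k_def by (rule LeastI)
          have k': "h x < 1 / (real k + 1)"
          proof (cases k)
            case 0
            have "1 / (real n + 1) \<le> 1" by simp
            from less_le_trans[OF lt this] 0 show ?thesis by simp
          next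
            case (Suc j)
            then have "\<not> 1 / (real j + 2) \<le> h x"
              unfolding k_def by (metis lessI not_less_Least)
            then show ?thesis by (simp add: Suc add.commute)
          qed
          have "n \<le> k"
          proof (rule ccontr)
            assume "\<not> n \<le> k"
            then have "1 / (real n + 1) \<le> 1 / (real k + 2)"
              by (intro divide_left_mono) auto
            with k lt show False by simp
          qed
          then have "x \<in> R (k - n + n)"
            using k k' x by (simp add: R_def)
          then show ?thesis by blast
        qed simp
      qed
      have "?H (X - F) \<le> ?H (A n) + ?H (\<Union>k. R (k + n))"
        by (rule order_trans[OF hausdorff_outer_mono[OF cov] hausdorff_outer_Un_le])
      also have "\<dots> \<le> ?H (A n) + (\<Sum>k. ?H (R (k + n)))"
        by (intro add_left_mono hausdorff_outer_UN_le)
      finally have 1: "?H (X - F) \<le> ?H (A n) + (\<Sum>k. ?H (R (k + n)))" .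
      have 2: "?H (X \<inter> F) + ?H (A n) \<le> ?H X"
      proof -
        have "?H (X \<inter> F) + ?H (A n) \<le> ?H ((X \<inter> F) \<union> A n)"
        proof (rule hausdorff_outer_separated)
          show "0 < 1 / (real n + 1)" by simp
          fix a b assume "a \<in> X \<inter> F" "b \<in> A n"
          then have "h a = 0" "1 / (real n + 1) \<le> h b"
            by (auto simp: h_def A_def)
          then show "1 / (real n + 1) \<le> dist a b"
            using h_dist[of b a] by (simp add: dist_commute)
        qed
        also have "\<dots> \<le> ?H X"
          by (rule hausdorff_outer_mono) (auto simp: A_def)
        finally show ?thesis .
      qed
      have "(\<Sum>k<n. ?H (R k)) + (?H (X \<inter> F) + ?H (X - F))
          \<le> (\<Sum>k<n. ?H (R k)) + (?H (X \<inter> F) + (?H (A n) + (\<Sum>k. ?H (R (k + n)))))"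
        by (intro add_left_mono 1)
      also have "\<dots> = (?H (X \<inter> F) + ?H (A n)) + ((\<Sum>k. ?H (R (k + n))) + (\<Sum>k<n. ?H (R k)))"
        by (simp add: ac_simps)
      also have "(\<Sum>k. ?H (R (k + n))) + (\<Sum>k<n. ?H (R k)) = S"
        unfolding S_def by (rule suminf_offset[symmetric]) auto
      also have "(?H (X \<inter> F) + ?H (A n)) + S \<le> ?H X + S"
        by (intro add_right_mono 2)
      finally show ?thesis .
    qed
    then have "S + (?H (X \<inter> F) + ?H (X - F)) \<le> ?H X + S"
      unfolding S_def by (rule ennreal_suminf_bound_add)
    then show ?thesis
      using S by (simp add: add.commute[of _ S] ennreal_add_left_cancel_le)
  qed
  moreover have "?H X \<le> ?H (X \<inter> F) + ?H (X - F)" for X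
    using hausdorff_outer_Un_le[of m "X \<inter> F" "X - F"] by (simp add: Int_Diff_Un)
  ultimately have "?H (X \<inter> F) + ?H (X - F) = ?H X" for X
    by (intro antisym)
  then show ?thesis
    by (auto simp: lambda_system_def Int_commute Diff_eq)
qed

lemma measure_space_hausdorff:
  "measure_space UNIV (sets (borel :: 'a::metric_space measure)) (hausdorff_outer m)"
proof -
  let ?L = "lambda_system UNIV UNIV (hausdorff_outer m :: 'a set \<Rightarrow> ennreal)"
  interpret P: sigma_algebra "UNIV :: 'a set" UNIV
    using sigma_algebra_Pow[of "UNIV :: 'a set"] by simp
  have ms: "measure_space UNIV ?L (hausdorff_outer m)"
    by (rule P.caratheodory_lemma[OF outer_measure_space_hausdorff])
  then interpret L: sigma_algebra UNIV ?L
    by (simp add: measure_space_def)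
  have "sets borel = sigma_sets UNIV (Collect closed :: 'a set set)"
    unfolding borel_eq_closed by simp
  also have "\<dots> \<subseteq> ?L"
    using closed_in_lambda_system_hausdorff by (intro L.sigma_sets_subset) auto
  finally have "sets borel \<subseteq> ?L" .
  moreover have "sigma_algebra UNIV (sets (borel :: 'a measure))"
    using sets.sigma_algebra_axioms[of "borel :: 'a measure"] by simp
  ultimately show ?thesis
    by (intro measure_down[OF ms])
qed

lemma emeasure_hausdorff_measure:
  "A \<in> sets borel \<Longrightarrow> emeasure (hausdorff_measure m) A = hausdorff_outer m A"
  using measure_space_hausdorff[where 'a='a, of m]
  by (intro emeasure_measure_of[OF hausdorff_measure_def])
     (auto simp: measure_space_def)


section \<open>Absolutely continuous part\<close>

definition mutually_singular :: "'a measure \<Rightarrow> 'a measure \<Rightarrow> bool" where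
  "mutually_singular M N \<longleftrightarrow>
     (\<exists>A\<in>sets M. emeasure M A = 0 \<and> emeasure N (space M - A) = 0)"

definition lebesgue_decomposition ::
  "'a measure \<Rightarrow> 'a measure \<Rightarrow> 'a measure \<Rightarrow> 'a measure \<Rightarrow> bool" where
  "lebesgue_decomposition M N Na Ns \<longleftrightarrow>
     sets Na = sets N \<and> sets Ns = sets N \<and>
     (\<forall>A\<in>sets N. emeasure N A = emeasure Na A + emeasure Ns A) \<and>
     absolutely_continuous M Na \<and> mutually_singular M Ns"

text \<open>
  \<open>ac_part M N\<close> is the absolutely continuous part of \<open>N\<close> with respect to \<open>M\<close>; the description is
  well defined for finite \<open>N\<close> by \<open>lebesgue_decomposition_ac_part\<close> and \<open>ac_part_eqI\<close>.
\<close>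

definition ac_part :: "'a measure \<Rightarrow> 'a measure \<Rightarrow> 'a measure" where
  "ac_part M N = (THE Na. \<exists>Ns. lebesgue_decomposition M N Na Ns)"

lemma lebesgue_decomposition_exists:
  assumes "finite_measure N" and sets: "sets N = sets M"
  shows "\<exists>Na Ns. lebesgue_decomposition M N Na Ns"
proof -
  interpret finite_measure N by fact
  have ne: "null_sets M \<noteq> {}" by blast
  obtain f :: "nat \<Rightarrow> ennreal" where f: "range f \<subseteq> emeasure N ` null_sets M"
    and Sup: "(SUP Z\<in>null_sets M. emeasure N Z) = Sup (range f)"
    using ennreal_Sup_countable_SUP[of "emeasure N ` null_sets M"] ne by auto
  then have "\<forall>n. \<exists>Z\<in>null_sets M. f n = emeasure N Z" by auto
  then obtain Z where Z: "\<And>n. Z n \<in> null_sets M" "\<And>n. f n = emeasure N (Z n)" by metis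
  define U where "U = (\<Union>n. Z n)"
  have U: "U \<in> null_sets M" unfolding U_def using Z by auto
  then have UM: "U \<in> sets M" and UN: "U \<in> sets N" using sets by auto
  have max: "emeasure N V \<le> emeasure N U" if "V \<in> null_sets M" for V
  proof -
    have "emeasure N V \<le> Sup (range f)"
      unfolding Sup[symmetric] using that by (rule SUP_upper)
    also have "\<dots> \<le> emeasure N U"
      using Z UN by (auto simp: U_def intro!: SUP_least emeasure_mono)
    finally show ?thesis .
  qed
  define Na where "Na = density N (indicator (space N - U))"
  define Ns where "Ns = density N (indicator U)"
  have Na: "emeasure Na A = emeasure N (A - U)" if "A \<in> sets N" for A
  proof -
    have "A \<inter> (space N - U) = A - U" using sets.sets_into_space[OF that] by auto
    then show ?thesis
      using that UN unfolding Na_def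
      by (subst emeasure_density) (auto simp: Int_commute simp flip: indicator_inter_arith)
  qed
  have Ns: "emeasure Ns A = emeasure N (A \<inter> U)" if "A \<in> sets N" for A
    using that UN unfolding Ns_def
    by (subst emeasure_density) (auto simp: Int_commute simp flip: indicator_inter_arith)
  have "lebesgue_decomposition M N Na Ns"
    unfolding lebesgue_decomposition_def
  proof (intro conjI ballI)
    show "sets Na = sets N" "sets Ns = sets N" by (auto simp: Na_def Ns_def)
    fix A assume A: "A \<in> sets N"
    then show "emeasure N A = emeasure Na A + emeasure Ns A"
      using UN plus_emeasure[of "A - U" N "A \<inter> U"]
      by (simp add: Na Ns Int_commute Un_Diff_Int disjoint_iff)
  next
    show "absolutely_continuous M Na"
      unfolding absolutely_continuous_def
    proof
      fix V assume V: "V \<in> null_sets M"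
      then have VN: "V \<in> sets N" using sets by auto
      have "emeasure N U + emeasure N (V - U) = emeasure N (U \<union> (V - U))"
        using UN VN by (intro plus_emeasure) auto
      also have "\<dots> \<le> emeasure N U"
        using V U by (intro max) auto
      finally have "emeasure N (V - U) = 0"
        using emeasure_finite[of U]
        by (metis add.right_neutral ennreal_add_left_cancel_le le_zero_eq infinity_ennreal_def)
      then show "V \<in> null_sets Na"
        using VN by (auto simp: Na null_sets_def Na_def[symmetric]) (simp add: Na_def)
    qed
    show "mutually_singular M Ns"
      unfolding mutually_singular_def
    proof (intro bexI conjI)
      show "emeasure M U = 0" "U \<in> sets M" using U by auto
      have "space M - U \<in> sets N" using UM sets by auto
      then show "emeasure Ns (space M - U) = 0"
        by (simp add: Ns Int_commute Diff_disjoint)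
    qed
  qed
  then show ?thesis by blast
qed

lemma lebesgue_decomposition_emeasure:
  assumes "finite_measure N" and sets: "sets N = sets M"
    and D: "lebesgue_decomposition M N Na Ns"
  obtains U where "U \<in> null_sets M"
    and "\<And>V A. V \<in> null_sets M \<Longrightarrow> U \<subseteq> V \<Longrightarrow> A \<in> sets N \<Longrightarrow> emeasure Na A = emeasure N (A - V)"
proof -
  have [simp]: "sets Na = sets N" "sets Ns = sets N"
    and add: "\<And>A. A \<in> sets N \<Longrightarrow> emeasure N A = emeasure Na A + emeasure Ns A"
    and ac: "absolutely_continuous M Na" and sing: "mutually_singular M Ns"
    using D by (auto simp: lebesgue_decomposition_def)
  obtain U where U: "U \<in> sets M" "emeasure M U = 0" "emeasure Ns (space M - U) = 0"
    using sing by (auto simp: mutually_singular_def)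
  have "emeasure Na A = emeasure N (A - V)"
    if V: "V \<in> null_sets M" and UV: "U \<subseteq> V" and A: "A \<in> sets N" for V A
  proof -
    have VN: "V \<in> sets N" using V sets by auto
    have "A \<inter> V \<in> null_sets M" using V A sets by (intro null_set_Int1) auto
    then have "emeasure Na (A \<inter> V) = 0" using ac by (auto simp: absolutely_continuous_def)
    moreover have "emeasure Na A = emeasure Na (A - V) + emeasure Na (A \<inter> V)"
      using A VN plus_emeasure[of "A - V" Na "A \<inter> V"] by (simp add: Int_commute Un_Diff_Int disjoint_iff)
    moreover have "emeasure Ns (A - V) \<le> emeasure Ns (space M - U)"
      using U A UV sets sets.sets_into_space[OF A] sets_eq_imp_space_eq[OF sets]
      by (intro emeasure_mono) auto
    ultimately show ?thesis
      using U A VN by (simp add: add sets.Diff)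
  qed
  then show ?thesis using U that by blast
qed

lemma ac_part_eqI:
  assumes N: "finite_measure N" and sets: "sets N = sets M"
    and D: "lebesgue_decomposition M N Na Ns"
  shows "ac_part M N = Na"
  unfolding ac_part_def
proof (rule the_equality)
  show "\<exists>Ns. lebesgue_decomposition M N Na Ns" using D by blast
  fix Na' assume "\<exists>Ns. lebesgue_decomposition M N Na' Ns"
  then obtain Ns' where D': "lebesgue_decomposition M N Na' Ns'" by blast
  obtain U where U: "U \<in> null_sets M"
    "\<And>V A. V \<in> null_sets M \<Longrightarrow> U \<subseteq> V \<Longrightarrow> A \<in> sets N \<Longrightarrow> emeasure Na A = emeasure N (A - V)"
    using lebesgue_decomposition_emeasure[OF N sets D] by blast
  obtain U' where U': "U' \<in> null_sets M"
    "\<And>V A. V \<in> null_sets M \<Longrightarrow> U' \<subseteq> V \<Longrightarrow> A \<in> sets N \<Longrightarrow> emeasure Na' A = emeasure N (A - V)"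
    using lebesgue_decomposition_emeasure[OF N sets D'] by blast
  have "U \<union> U' \<in> null_sets M" using U U' by auto
  then have "emeasure Na' A = emeasure Na A" if "A \<in> sets N" for A
    using U(2)[of "U \<union> U'" A] U'(2)[of "U \<union> U'" A] that by simp
  moreover have "sets Na' = sets N" "sets Na = sets N"
    using D D' by (auto simp: lebesgue_decomposition_def)
  ultimately show "Na' = Na" by (intro measure_eqI) auto
qed

lemma lebesgue_decomposition_ac_part:
  assumes "finite_measure N" "sets N = sets M"
  shows "\<exists>Ns. lebesgue_decomposition M N (ac_part M N) Ns"
  using lebesgue_decomposition_exists[OF assms] ac_part_eqI[OF assms] by metis


section \<open>Transversal families\<close>

text \<open>
  The Frechet derivative as a bounded linear map, so that \<^const>\<open>norm\<close> is the operator norm and the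
  operation can be iterated.
\<close>

definition Deriv :: "('a::real_normed_vector \<Rightarrow> 'b::real_normed_vector) \<Rightarrow> 'a \<Rightarrow> 'a \<Rightarrow>\<^sub>L 'b" where
  "Deriv f u = Blinfun (frechet_derivative f (at u))"

lemma has_derivative_Deriv: "f differentiable (at u) \<Longrightarrow> (f has_derivative blinfun_apply (Deriv f u)) (at u)"
  by (simp add: Deriv_def frechet_derivative_works bounded_linear_Blinfun_apply
      has_derivative_bounded_linear)

definition C2_on :: "'a::real_normed_vector set \<Rightarrow> ('a \<Rightarrow> 'b::real_normed_vector) \<Rightarrow> bool" where
  "C2_on \<Lambda> f \<longleftrightarrow>
     (\<forall>u\<in>\<Lambda>. f differentiable (at u)) \<and> continuous_on \<Lambda> (Deriv f) \<and>
     (\<forall>u\<in>\<Lambda>. Deriv f differentiable (at u)) \<and> continuous_on \<Lambda> (Deriv (Deriv f))"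

text \<open>The \<open>m\<close>-dimensional Jacobian; \<^const>\<open>jacobian\<close> is the library's Jacobian matrix.\<close>

definition jacobian_det :: "(real ^ 'l \<Rightarrow> real ^ 'm) \<Rightarrow> real ^ 'l \<Rightarrow> real" where
  "jacobian_det f u =
     sqrt (det (jacobian f (at u) ** transpose (jacobian f (at u))))"

text \<open>\<open>P x u\<close> stands for the value at \<open>x\<close> of the map with parameter \<open>u \<in> \<Lambda>\<close>.\<close>

definition diff_quot ::
  "('x::metric_space \<Rightarrow> real ^ 'l \<Rightarrow> real ^ 'm) \<Rightarrow> 'x \<Rightarrow> 'x \<Rightarrow> real ^ 'l \<Rightarrow> real ^ 'm" where
  "diff_quot P x x' u = (P x u - P x' u) /\<^sub>R dist x x'"

definition transversal_family ::
  "(real ^ 'l) set \<Rightarrow> ('x::metric_space \<Rightarrow> real ^ 'l \<Rightarrow> real ^ 'm) \<Rightarrow> bool" where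
  "transversal_family \<Lambda> P \<longleftrightarrow>
     CARD('m) \<le> CARD('l) \<and> open \<Lambda> \<and> bounded \<Lambda> \<and>
     continuous_on (UNIV \<times> \<Lambda>) (\<lambda>(x, u). P x u) \<and>
     (\<forall>x. C2_on \<Lambda> (P x)) \<and>
     (\<exists>B. \<forall>u\<in>\<Lambda>. \<forall>x. norm (Deriv (P x) u) \<le> B) \<and>
     (\<exists>B. \<forall>u\<in>\<Lambda>. \<forall>x. norm (Deriv (Deriv (P x)) u) \<le> B) \<and>
     (\<exists>C'>0. \<forall>u\<in>\<Lambda>. \<forall>x x'. x \<noteq> x' \<longrightarrow>
        norm (diff_quot P x x' u) \<le> C' \<longrightarrow> \<bar>jacobian_det (diff_quot P x x') u\<bar> \<ge> C') \<and>
     (\<exists>C''>0. \<forall>u\<in>\<Lambda>. \<forall>x x'. x \<noteq> x' \<longrightarrow>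
        norm (Deriv (diff_quot P x x') u) \<le> C'' \<and>
        norm (Deriv (Deriv (diff_quot P x x')) u) \<le> C'')"

end

theory Submission
  imports Defs
begin

text \<open>
  Write \<open>D \<nu> y\<close> for the lower \<open>m\<close>-dimensional density of a finite measure \<open>\<nu>\<close> at \<open>y\<close>. By Vitali's
  covering lemma the absolutely continuous part of \<open>\<nu>\<close> is its restriction to \<open>{y. D \<nu> y < \<infinity>}\<close>.
  Transversality says that \<open>{u. norm (P x u - P x' u) \<le> \<rho>}\<close> has volume \<open>O(\<rho>\<^sup>m)\<close>, uniformly for
  \<open>x, x'\<close> at distance at least \<open>\<delta>\<close>. Hence, if \<open>A\<close> and \<open>C\<close> are at distance at least \<open>\<delta>\<close>, Fatou's lemma
  and Fubini's theorem show that for almost every \<open>u\<close> the image of \<open>\<mu>|C\<close> has finite lower density at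
  \<open>P x u\<close> for \<open>\<mu>\<close>-almost every \<open>x \<in> A\<close>. When the image of \<open>\<mu>\<close> is singular, the image of \<open>\<mu>|C\<close> has
  infinite lower density at almost all of its own points, so the images of \<open>\<mu>|A\<close> and \<open>\<mu>|C\<close> live on
  disjoint sets. Countably many pairs \<open>(A, C)\<close> separate the points of the space, which
  transversality forces to be separable.
\<close>

section \<open>Vitali packing\<close>

text \<open>The volume bound behind the argument blows up like \<open>\<delta> ^ (- m)\<close>, and
  \<open>\<mu>\<close> may concentrate arbitrarily near a point, so the image of the whole of
  \<open>\<mu>\<close> has no controlled density at \<open>P x u\<close>. The mass near
  \<open>x\<close> must be cut away, which is why images of separated pieces are compared instead of
  one energy integral over all pairs of points. Only finiteness, nullity and positivity matter.
  Hence the factors \<open>5 ^ m\<close> lost in Vitali coverings, the dyadic choice of radii and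
  the normalisation of densities are harmless. Lower rather than upper densities are used because
  they are what Fatou's lemma bounds, and they suffice for both halves of the Lebesgue
  decomposition. The parameters excluded by Fatou's lemma depend on \<open>x\<close>. Passing from
  "for every \<open>x\<close>, almost every \<open>u\<close>" to "for almost every \<open>u\<close>,
  almost every \<open>x\<close>" requires joint measurability in \<open>(x, u)\<close>, while open
  sets of a product of nonseparable spaces can lie outside the product sigma-algebra. Separability
  thus serves twice: here and for the countable family of pairs.\<close>

text \<open>The set function \<open>w\<close> is only asked to be subadditive on countable Borel covers of \<open>E\<close>, so that it
  can be a measure as well as the weight in the definition of the Hausdorff measure.\<close>

lemma vitali_packing:
  fixes E :: "'a::euclidean_space set" and w :: "'a set \<Rightarrow> ennreal"
  assumes r: "\<And>y. y \<in> E \<Longrightarrow> 0 < r y \<and> r y \<le> B \<and> cball y (r y) \<subseteq> G"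
    and \<kappa>: "sets \<kappa> = sets borel" "G \<in> sets borel"
    and w: "\<And>A. range A \<subseteq> sets borel \<Longrightarrow> E \<subseteq> (\<Union>i::nat. A i) \<Longrightarrow> w0 \<le> (\<Sum>i. w (A i))" "w {} = 0"
    and le: "\<And>y. y \<in> E \<Longrightarrow> w (cball y (5 * r y)) \<le> emeasure \<kappa> (cball y (r y))"
  shows "w0 \<le> emeasure \<kappa> G"
proof -
  have "E \<subseteq> (\<Union>y\<in>E. cball y (r y))" using r by force
  then obtain C where C: "countable C" "C \<subseteq> E"
    "pairwise (\<lambda>i j. disjnt (cball i (r i)) (cball j (r j))) C" "E \<subseteq> (\<Union>i\<in>C. cball i (5 * r i))"
    using Vitali_covering_lemma_cballs[of E "\<lambda>y. y" r E B] r by (metis (no_types, lifting))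
  \<comment> \<open>\<open>w\<close> is tested on sequences, so the countable set \<open>C\<close>
    is spread over the naturals. It may be finite; indices outside \<open>I\<close> carry the empty
    set, which is where \<open>w {} = 0\<close> enters.\<close>
  define I where "I = to_nat_on C ` C"
  define c where "c = from_nat_into C"
  have c: "c i \<in> C" if "i \<in> I" for i
    using that C(1) by (auto simp: I_def c_def)
  have c_inj: "c i \<noteq> c j" if "i \<in> I" "j \<in> I" "i \<noteq> j" for i j
    using that C(1) by (auto simp: I_def c_def)
  have c_surj: "\<exists>i\<in>I. c i = y" if "y \<in> C" for y
    using that C(1) by (auto simp: I_def c_def)
  define A where "A i = (if i \<in> I then cball (c i) (5 * r (c i)) else {})" for i
  define D where "D i = (if i \<in> I then cball (c i) (r (c i)) else {})" for i
  have "w0 \<le> (\<Sum>i. w (A i))"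
  proof (rule w(1))
    show "range A \<subseteq> sets borel" by (auto simp: A_def)
    show "E \<subseteq> (\<Union>i. A i)"
    proof
      fix x assume "x \<in> E"
      then obtain y where "y \<in> C" "x \<in> cball y (5 * r y)" using C(4) by auto
      with c_surj[of y] show "x \<in> (\<Union>i. A i)" by (auto simp: A_def)
    qed
  qed
  also have "\<dots> \<le> (\<Sum>i. emeasure \<kappa> (D i))"
    using le c C(2) w(2) by (intro suminf_le) (auto simp: A_def D_def)
  also have "\<dots> = emeasure \<kappa> (\<Union>i. D i)"
  proof (rule suminf_emeasure)
    show "range D \<subseteq> sets \<kappa>" by (auto simp: D_def \<kappa>)
    show "disjoint_family D"
      unfolding disjoint_family_on_def
    proof (intro ballI impI)
      fix i j :: nat assume "i \<noteq> j"
      then show "D i \<inter> D j = {}"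
        using C(3) c c_inj unfolding pairwise_def disjnt_def D_def by auto
    qed
  qed
  also have "\<dots> \<le> emeasure \<kappa> G"
  proof (rule emeasure_mono)
    have "D i \<subseteq> G" for i
      using r[of "c i"] c[of i] C(2) by (auto simp: D_def)
    then show "(\<Union>i. D i) \<subseteq> G" by blast
  qed (simp add: \<kappa>)
  finally show ?thesis .
qed

lemma vitali_packing_measure:
  fixes E :: "'a::euclidean_space set"
  assumes r: "\<And>y. y \<in> E \<Longrightarrow> 0 < r y \<and> r y \<le> B \<and> cball y (r y) \<subseteq> G"
    and \<kappa>: "sets \<kappa> = sets borel" "G \<in> sets borel"
    and \<nu>: "sets \<nu> = sets borel" "E \<in> sets borel"
    and le: "\<And>y. y \<in> E \<Longrightarrow> emeasure \<nu> (cball y (5 * r y)) \<le> emeasure \<kappa> (cball y (r y))"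
  shows "emeasure \<nu> E \<le> emeasure \<kappa> G"
proof (rule vitali_packing[OF r \<kappa> _ _ le])
  fix A :: "nat \<Rightarrow> 'a set" assume A: "range A \<subseteq> sets borel" "E \<subseteq> (\<Union>i. A i)"
  then have "emeasure \<nu> E \<le> emeasure \<nu> (\<Union>i. A i)"
    using \<nu> by (intro emeasure_mono) auto
  also have "\<dots> \<le> (\<Sum>i. emeasure \<nu> (A i))"
    using A \<nu> by (intro emeasure_subadditive_countably) auto
  finally show "emeasure \<nu> E \<le> (\<Sum>i. emeasure \<nu> (A i))" .
qed auto

lemma emeasure_lborel_cball_scale:
  fixes y :: "'a::euclidean_space"
  assumes "0 \<le> r" "0 \<le> k"
  shows "emeasure lborel (cball (z::'a) (k * r)) = ennreal (k ^ DIM('a)) * emeasure lborel (cball y r)"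
  using assms by (simp add: emeasure_cball power_mult_distrib ennreal_mult[symmetric] ac_simps)

text \<open>The packing lemma is applied to the push-forward of Lebesgue measure on
  \<open>E\<close>: by expansion the preimage of a ball of radius \<open>5 * r\<close> lies in a
  ball of radius \<open>5 * r / c\<close>, whence the constant. The packed balls of radius
  \<open>r\<close> must fit into \<open>G\<close>, so \<open>G\<close> contains a neighbourhood of
  the image and not only the image.\<close>

lemma emeasure_expanding_preimage_le:
  fixes F :: "'a::euclidean_space \<Rightarrow> 'a"
  assumes E: "E \<in> sets borel" and F: "continuous_on E F" and c: "0 < c"
    and exp: "\<And>u v. u \<in> E \<Longrightarrow> v \<in> E \<Longrightarrow> c * dist u v \<le> dist (F u) (F v)"
    and r: "0 < r" "\<And>u. u \<in> E \<Longrightarrow> cball (F u) r \<subseteq> G" and G: "G \<in> sets borel"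
  shows "emeasure lborel E \<le> ennreal ((5 / c) ^ DIM('a)) * emeasure lborel G"
proof -
  have Fm: "F \<in> measurable (restrict_space lborel E) borel"
    using borel_measurable_continuous_on_restrict[OF F]
    by (simp add: measurable_cong_sets[OF sets_restrict_space_cong[OF sets_lborel] refl])
  define \<nu> where "\<nu> = distr (restrict_space lborel E) borel F"
  have \<nu>: "emeasure \<nu> A = emeasure lborel {u\<in>E. F u \<in> A}" if "A \<in> sets borel" for A
  proof -
    have "emeasure \<nu> A = emeasure (restrict_space lborel E) {u\<in>E. F u \<in> A}"
      unfolding \<nu>_def using that Fm E
      by (subst emeasure_distr) (auto simp: space_restrict_space intro!: arg_cong[where f="emeasure _"])
    also have "\<dots> = emeasure lborel {u\<in>E. F u \<in> A}"
      using E by (subst emeasure_restrict_space) auto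
    finally show ?thesis .
  qed
  let ?\<kappa> = "scale_measure (ennreal ((5 / c) ^ DIM('a))) lborel :: 'a measure"
  have "emeasure lborel E \<le> emeasure ?\<kappa> G"
  proof (rule vitali_packing[where r="\<lambda>_. r" and B=r and E="F ` E" and w="emeasure \<nu>"])
    fix A :: "nat \<Rightarrow> 'a set" assume A: "range A \<subseteq> sets borel" "F ` E \<subseteq> (\<Union>i. A i)"
    have "E = {u\<in>E. F u \<in> (\<Union>i. A i)}" using A by auto
    then have "emeasure lborel E \<le> emeasure \<nu> (\<Union>i. A i)"
      using A by (subst \<nu>) auto
    also have "\<dots> \<le> (\<Sum>i. emeasure \<nu> (A i))"
      using A by (intro emeasure_subadditive_countably) (auto simp: \<nu>_def)
    finally show "emeasure lborel E \<le> (\<Sum>i. emeasure \<nu> (A i))" .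
  next
    fix y assume "y \<in> F ` E"
    then obtain u where u: "u \<in> E" "y = F u" by auto
    have "emeasure \<nu> (cball y (5 * r)) \<le> emeasure lborel (cball u ((5 / c) * r))"
    proof -
      have "{v \<in> E. F v \<in> cball y (5 * r)} \<subseteq> cball u (5 / c * r)"
      proof
        fix v assume v: "v \<in> {v \<in> E. F v \<in> cball y (5 * r)}"
        then have "c * dist u v \<le> 5 * r" using exp[OF u(1), of v] u(2) by auto
        then show "v \<in> cball u (5 / c * r)" using c by (simp add: field_simps)
      qed
      then show ?thesis by (subst \<nu>) (auto intro: emeasure_mono)
    qed
    also have "\<dots> = emeasure ?\<kappa> (cball y r)"
      using r c by (subst emeasure_lborel_cball_scale[of _ _ _ y]) (auto simp: emeasure_scale_measure)
    finally show "emeasure \<nu> (cball y (5 * r)) \<le> emeasure ?\<kappa> (cball y r)" .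
  qed (use r G in auto)
  then show ?thesis by (simp add: emeasure_scale_measure)
qed


section \<open>Lower densities and the absolutely continuous part\<close>

text \<open>The usual lower density without the constant \<open>unit_ball_vol\<close>, and along the
  radii \<open>(1 / 2) ^ n\<close> only. By monotonicity in the radius this changes the value by a
  bounded factor, and a sequence of radii keeps measurability and Fatou's lemma available.\<close>

definition lower_dens :: "'a::euclidean_space measure \<Rightarrow> 'a \<Rightarrow> ennreal" where
  "lower_dens \<nu> y = liminf (\<lambda>n. ennreal ((2 ^ n) ^ DIM('a)) * emeasure \<nu> (cball y ((1 / 2) ^ n)))"

lemma borel_measurable_emeasure_cball:
  fixes \<nu> :: "'a::euclidean_space measure"
  assumes "finite_measure \<nu>" "sets \<nu> = sets borel"
  shows "(\<lambda>y. emeasure \<nu> (cball y r)) \<in> borel_measurable borel"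
proof -
  interpret finite_measure \<nu> by fact
  have "{p :: 'a \<times> 'a. dist (fst p) (snd p) \<le> r} \<in> sets (borel \<Otimes>\<^sub>M borel)"
    unfolding borel_prod by (intro borel_closed closed_Collect_le continuous_intros)
  then have "{p :: 'a \<times> 'a. dist (fst p) (snd p) \<le> r} \<in> sets (borel \<Otimes>\<^sub>M \<nu>)"
    using assms(2) by (metis sets_pair_measure_cong)
  from measurable_emeasure_Pair[OF this] show ?thesis
    by (simp add: cball_def vimage_def)
qed

lemma borel_measurable_lower_dens [measurable (raw)]:
  fixes \<nu> :: "'a::euclidean_space measure"
  assumes "finite_measure \<nu>" "sets \<nu> = sets borel"
  shows "lower_dens \<nu> \<in> borel_measurable borel"
  unfolding lower_dens_def
  using borel_measurable_emeasure_cball[OF assms] by measurable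

lemma cball_scaled_mass_le:
  fixes t :: real
  assumes "ennreal ((2 ^ n) ^ d) * a \<le> ennreal t" "0 \<le> t"
  shows "a \<le> ennreal (t * ((1 / 2) ^ n) ^ d)"
proof -
  have "a = ennreal (((1 / 2) ^ n) ^ d) * (ennreal ((2 ^ n) ^ d) * a)"
    by (simp add: mult.assoc[symmetric] ennreal_mult[symmetric] power_mult_distrib[symmetric])
  also have "\<dots> \<le> ennreal (((1 / 2) ^ n) ^ d) * ennreal t"
    by (intro mult_left_mono assms) auto
  finally show ?thesis using assms(2) by (simp add: ennreal_mult mult.commute)
qed

lemma ennreal_le_all_pos_mult_imp_zero:
  assumes "\<And>e::real. 0 < e \<Longrightarrow> a \<le> K * ennreal e" "K < top"
  shows "a = 0"
proof -
  obtain k where k: "K = ennreal k" "0 \<le> k" using assms(2) by (cases K) auto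
  have "a \<le> 0 + ennreal e" if "0 < e" for e
  proof -
    have "a \<le> K * ennreal (e / (k + 1))" using that k by (intro assms(1)) auto
    also have "\<dots> \<le> ennreal e"
      using that k by (auto simp: ennreal_mult[symmetric] divide_simps intro!: ennreal_leI)
    finally show ?thesis by simp
  qed
  then have "a \<le> 0" by (rule ennreal_le_epsilon)
  then show ?thesis by simp
qed

lemma lborel_null_set_outer_open:
  assumes N: "N \<in> null_sets lborel" and e: "0 < (e::real)"
  obtains G where "open G" "N \<subseteq> G" "emeasure lborel G \<le> e"
proof -
  have Nb: "N \<in> sets borel" using N by auto
  obtain G where G: "open G" "N \<subseteq> G" "emeasure lborel (G - N) < e"
    using outer_regular_lborel[OF Nb e] by metis
  have "G - N \<in> sets lborel" using G(1) Nb by auto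
  then have "emeasure lborel G \<le> e"
    using G N emeasure_Un_null_set[of "G - N" lborel N] by (simp add: Un_absorb2)
  with G show ?thesis using that by blast
qed

text \<open>Where the lower density is below \<open>t\<close>, arbitrarily small balls have mass at
  most a multiple of their volume. Packing such balls into an open superset of \<open>N\<close> of
  volume at most \<open>e\<close> bounds the mass by \<open>K * e\<close>, with \<open>K\<close>
  independent of \<open>e\<close>.\<close>

lemma emeasure_finite_lower_dens_null:
  fixes \<nu> :: "'a::euclidean_space measure"
  assumes fin: "finite_measure \<nu>" and sets: "sets \<nu> = sets borel" and N: "N \<in> null_sets lborel"
  shows "emeasure \<nu> {y\<in>N. lower_dens \<nu> y < top} = 0"
proof -
  have Nb [measurable]: "N \<in> sets borel" using N by auto
  note [measurable] = borel_measurable_lower_dens[OF fin sets]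
  define E where "E t = {y\<in>N. lower_dens \<nu> y < of_nat t}" for t
  have Eb: "E t \<in> sets borel" for t unfolding E_def by measurable
  have "emeasure \<nu> (E t) = 0" for t
  proof (rule ennreal_le_all_pos_mult_imp_zero)
    fix e :: real assume e: "0 < e"
    \<comment> \<open>Chosen so that \<open>K\<close> times the volume of a ball of radius
      \<open>r\<close> equals \<open>t * (5 * r) ^ DIM('a)\<close>.\<close>
    define K where "K = real t * 5 ^ DIM('a) / unit_ball_vol DIM('a)"
    obtain G where G: "open G" "N \<subseteq> G" and LG: "emeasure lborel G \<le> e"
      using lborel_null_set_outer_open[OF N e] by blast
    let ?\<kappa> = "scale_measure (ennreal K) lborel :: 'a measure"
    have ex: "\<exists>r. (0 < r \<and> r \<le> 1 \<and> cball y r \<subseteq> G) \<and>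
        emeasure \<nu> (cball y (5 * r)) \<le> emeasure ?\<kappa> (cball y r)" if y: "y \<in> E t" for y
    proof -
      have "y \<in> G" using y G by (auto simp: E_def)
      then obtain d where d: "0 < d" "cball y d \<subseteq> G"
        using \<open>open G\<close> open_contains_cball by blast
      have "eventually (\<lambda>n. (1 / 2 :: real) ^ n < d) sequentially"
        using d by (intro order_tendstoD(2)[OF LIMSEQ_realpow_zero]) auto
      moreover have "frequently (\<lambda>n. ennreal ((2 ^ n) ^ DIM('a)) * emeasure \<nu> (cball y ((1 / 2) ^ n))
          \<le> of_nat t) sequentially"
      proof (rule ccontr)
        assume "\<not> ?thesis"
        then have "eventually (\<lambda>n. of_nat t \<le> ennreal ((2 ^ n) ^ DIM('a)) *
            emeasure \<nu> (cball y ((1 / 2) ^ n))) sequentially"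
          by (auto simp: frequently_def not_le elim: eventually_mono)
        then have "of_nat t \<le> lower_dens \<nu> y" unfolding lower_dens_def by (rule Liminf_bounded)
        then show False using y by (auto simp: E_def)
      qed
      ultimately obtain n where n: "(1 / 2 :: real) ^ n < d"
        "ennreal ((2 ^ n) ^ DIM('a)) * emeasure \<nu> (cball y ((1 / 2) ^ n)) \<le> ennreal (real t)"
        by (metis (mono_tags, lifting) frequently_eventually_frequently frequently_ex
            ennreal_of_nat_eq_real_of_nat)
      \<comment> \<open>The density bound concerns the enlarged ball, so the dyadic radius is
        \<open>5 * r\<close>.\<close>
      define r where "r = (1 / 2 :: real) ^ n / 5"
      have r: "0 < r" "r \<le> 1" "r \<le> d" "5 * r = (1 / 2) ^ n"
        using n d power_le_one[of "1/2 :: real" n] by (auto simp: r_def)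
      have "emeasure \<nu> (cball y (5 * r)) \<le> ennreal (real t * (5 * r) ^ DIM('a))"
        unfolding r(4) using n by (intro cball_scaled_mass_le) auto
      also have "\<dots> = emeasure ?\<kappa> (cball y r)"
        using r(1,2) less_imp_neq[OF unit_ball_vol_pos[of "real DIM('a)"]]
        by (simp add: emeasure_scale_measure emeasure_cball K_def ennreal_mult[symmetric]
            power_mult_distrib)
      finally show ?thesis using r d by (intro exI[of _ r]) (auto dest: subsetD)
    qed
    then obtain r where r: "\<And>y. y \<in> E t \<Longrightarrow> 0 < r y \<and> r y \<le> 1 \<and> cball y (r y) \<subseteq> G"
      "\<And>y. y \<in> E t \<Longrightarrow> emeasure \<nu> (cball y (5 * r y)) \<le> emeasure ?\<kappa> (cball y (r y))"
      by metis
    have "emeasure \<nu> (E t) \<le> emeasure ?\<kappa> G"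
      by (rule vitali_packing_measure[OF r(1) _ _ sets Eb r(2)]) (use G in auto)
    also have "\<dots> \<le> ennreal K * ennreal e"
      using LG by (auto simp: emeasure_scale_measure intro: mult_left_mono)
    finally show "emeasure \<nu> (E t) \<le> ennreal K * ennreal e" .
  qed auto
  then have "emeasure \<nu> (\<Union>t. E t) = 0"
    using Eb sets by (intro emeasure_UN_eq_0) auto
  moreover have "{y\<in>N. lower_dens \<nu> y < top} = (\<Union>t. E t)"
    by (auto simp: E_def dest: ennreal_Ex_less_of_nat intro: less_trans of_nat_less_top)
  ultimately show ?thesis by simp
qed

text \<open>The converse packing, with the roles of volume and mass exchanged: around a point of
  infinite density some ball has volume at most a multiple of \<open>e\<close> times its mass, and
  disjoint balls have total mass at most that of the whole space. A single dyadic radius per point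
  is enough because the packing takes place in \<open>UNIV\<close>.\<close>

lemma infinite_lower_dens_null_set:
  fixes \<nu> :: "'a::euclidean_space measure"
  assumes fin: "finite_measure \<nu>" and sets: "sets \<nu> = sets borel"
  shows "{y. lower_dens \<nu> y = top} \<in> null_sets lborel"
proof -
  note [measurable] = borel_measurable_lower_dens[OF fin sets]
  interpret finite_measure \<nu> by fact
  define E where "E = {y. lower_dens \<nu> y = top}"
  have Eb: "E \<in> sets borel" unfolding E_def by measurable
  define k where "k = unit_ball_vol DIM('a) * 5 ^ DIM('a)"
  have k: "0 < k" by (simp add: k_def)
  have "emeasure lborel E = 0"
  proof (rule ennreal_le_all_pos_mult_imp_zero)
    fix e :: real assume e: "0 < e"
    let ?\<kappa> = "scale_measure (ennreal (k * e)) \<nu>"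
    have ex: "\<exists>r. (0 < r \<and> r \<le> 1 \<and> cball y r \<subseteq> UNIV) \<and>
        emeasure lborel (cball y (5 * r)) \<le> emeasure ?\<kappa> (cball y r)" if y: "y \<in> E" for y
    proof -
      have "\<exists>n. ennreal (1 / e) \<le> ennreal ((2 ^ n) ^ DIM('a)) * emeasure \<nu> (cball y ((1 / 2) ^ n))"
      proof (rule ccontr)
        assume "\<not> ?thesis"
        then have "lower_dens \<nu> y \<le> ennreal (1 / e)"
          unfolding lower_dens_def
          by (intro order_trans[OF Liminf_le_Limsup Limsup_bounded]) (auto simp: not_le less_imp_le)
        then show False using y by (auto simp: E_def top_unique)
      qed
      then obtain n where n: "ennreal (1 / e) \<le> ennreal ((2 ^ n) ^ DIM('a)) * emeasure \<nu> (cball y ((1 / 2) ^ n))"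
        by blast
      define r where "r = (1 / 2 :: real) ^ n"
      have r: "0 < r" "r \<le> 1" by (auto simp: r_def power_le_one)
      have "ennreal (r ^ DIM('a)) = ennreal (e * r ^ DIM('a)) * ennreal (1 / e)"
        using e r by (simp add: ennreal_mult[symmetric])
      also have "\<dots> \<le> ennreal (e * r ^ DIM('a)) * (ennreal ((2 ^ n) ^ DIM('a)) * emeasure \<nu> (cball y r))"
        using n unfolding r_def by (intro mult_left_mono) auto
      also have "\<dots> = ennreal e * emeasure \<nu> (cball y r)"
        using e by (simp add: r_def ennreal_mult[symmetric] mult.assoc[symmetric])
          (simp add: mult.assoc power_mult_distrib[symmetric])
      finally have *: "ennreal (r ^ DIM('a)) \<le> ennreal e * emeasure \<nu> (cball y r)" .
      have "emeasure lborel (cball y (5 * r)) = ennreal k * ennreal (r ^ DIM('a))"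
        using r by (simp add: emeasure_cball k_def ennreal_mult[symmetric] power_mult_distrib)
      also have "\<dots> \<le> ennreal k * (ennreal e * emeasure \<nu> (cball y r))"
        by (intro mult_left_mono *) auto
      finally have "emeasure lborel (cball y (5 * r)) \<le> emeasure ?\<kappa> (cball y r)"
        using k e by (simp add: emeasure_scale_measure ennreal_mult mult.assoc)
      then show ?thesis using r by (intro exI[of _ r]) auto
    qed
    then obtain r where r: "\<And>y. y \<in> E \<Longrightarrow> 0 < r y \<and> r y \<le> 1 \<and> cball y (r y) \<subseteq> UNIV"
      "\<And>y. y \<in> E \<Longrightarrow> emeasure lborel (cball y (5 * r y)) \<le> emeasure ?\<kappa> (cball y (r y))"
      by metis
    have "emeasure lborel E \<le> emeasure ?\<kappa> UNIV"
      by (rule vitali_packing_measure[OF r(1) _ _ _ Eb r(2)]) (use sets in auto)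
    also have "\<dots> = (ennreal k * emeasure \<nu> UNIV) * ennreal e"
      using k e by (simp add: emeasure_scale_measure ennreal_mult ac_simps)
    finally show "emeasure lborel E \<le> (ennreal k * emeasure \<nu> UNIV) * ennreal e" .
  next
    show "ennreal k * emeasure \<nu> UNIV < top"
      using emeasure_finite[of UNIV] by (simp add: ennreal_mult_eq_top_iff less_top[symmetric])
  qed
  then show ?thesis using Eb by (simp add: E_def[symmetric] null_sets_def)
qed

section \<open>Hausdorff and Lebesgue null sets\<close>

text \<open>Vitali balls inside a small open superset of \<open>N\<close> give, after enlargement, a
  cover admissible at scale \<open>d\<close> whose weight is at most \<open>5 ^ DIM('a)\<close>
  times the volume of that superset.\<close>

lemma hausdorff_outer_eq_0_if_lborel_null:
  fixes N :: "'a::euclidean_space set"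
  assumes "N \<in> null_sets lborel"
  shows "hausdorff_outer DIM('a) N = 0"
proof -
  have "hausdorff_pre DIM('a) d N = 0" if d: "0 < d" for d
  proof (rule ennreal_le_all_pos_mult_imp_zero)
    fix e :: real assume e: "0 < e"
    obtain G where G: "open G" "N \<subseteq> G" and LG: "emeasure lborel G \<le> e"
      using lborel_null_set_outer_open[OF assms e] by blast
    \<comment> \<open>The value \<open>top\<close> on inadmissible sets makes the subadditivity
      required by the packing lemma trivial for covers that \<open>hausdorff_pre\<close>
      ignores.\<close>
    define w :: "'a set \<Rightarrow> ennreal" where
      "w A = (if bounded A \<and> diameter A \<le> d then hausdorff_weight DIM('a) A else top)" for A
    let ?\<kappa> = "scale_measure (ennreal (5 ^ DIM('a))) lborel :: 'a measure"
    \<comment> \<open>With \<open>d / 10\<close> the enlarged ball of radius \<open>5 * r\<close>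
      has diameter at most \<open>d\<close>.\<close>
    have "\<exists>r. 0 < r \<and> r \<le> d / 10 \<and> cball y r \<subseteq> G" if y: "y \<in> N" for y
    proof -
      obtain s where s: "0 < s" "cball y s \<subseteq> G"
        using y G \<open>open G\<close> open_contains_cball by blast
      then show ?thesis using d by (intro exI[of _ "min s (d / 10)"]) auto
    qed
    then obtain r where r: "\<And>y. y \<in> N \<Longrightarrow> 0 < r y \<and> r y \<le> d / 10 \<and> cball y (r y) \<subseteq> G"
      by metis
    have "hausdorff_pre DIM('a) d N \<le> emeasure ?\<kappa> G"
    proof (rule vitali_packing[OF r])
      fix A :: "nat \<Rightarrow> 'a set" assume A: "N \<subseteq> (\<Union>i. A i)"
      show "hausdorff_pre DIM('a) d N \<le> (\<Sum>i. w (A i))"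
      proof (cases "\<forall>i. bounded (A i) \<and> diameter (A i) \<le> d")
        case True
        then have "hausdorff_pre DIM('a) d N \<le> (\<Sum>i. hausdorff_weight DIM('a) (A i))"
          unfolding hausdorff_pre_def using A by (intro INF_lower) (auto simp: hausdorff_covers_def)
        with True show ?thesis by (simp add: w_def)
      next
        case False
        then obtain i where "\<not> (bounded (A i) \<and> diameter (A i) \<le> d)" by blast
        then have "w (A i) = top" unfolding w_def by (rule if_not_P)
        moreover have "w (A i) \<le> (\<Sum>i. w (A i))"
          using sum_le_suminf[of "\<lambda>i. w (A i)" "{i}"] by simp
        ultimately show ?thesis by (simp add: top_unique)
      qed
    next
      show "w {} = 0" using d by (simp add: w_def diameter_empty)
      fix y assume "y \<in> N"
      then have ry: "0 < r y" "r y \<le> d / 10" using r by auto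
      then have "w (cball y (5 * r y)) = ennreal (unit_ball_vol (real DIM('a)) * (5 * r y) ^ DIM('a))"
        by (simp add: w_def hausdorff_weight_def diameter_cball)
      also have "\<dots> = emeasure ?\<kappa> (cball y (r y))"
        using ry by (simp add: emeasure_scale_measure emeasure_cball ennreal_mult[symmetric]
            power_mult_distrib ac_simps)
      finally show "w (cball y (5 * r y)) \<le> emeasure ?\<kappa> (cball y (r y))" by simp
    qed (use G in auto)
    also have "\<dots> \<le> ennreal (5 ^ DIM('a)) * ennreal e"
      using LG by (simp only: emeasure_scale_measure) (intro mult_left_mono, auto)
    finally show "hausdorff_pre DIM('a) d N \<le> ennreal (5 ^ DIM('a)) * ennreal e" .
  qed simp
  then have "hausdorff_outer DIM('a) N \<le> 0"
    unfolding hausdorff_outer_def by (intro SUP_least) simp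
  then show ?thesis by simp
qed

text \<open>Each covering set lies in a ball centred at one of its points with its diameter as
  radius. This loses a factor \<open>2 ^ DIM('a)\<close> against \<open>hausdorff_weight\<close>,
  harmless for null sets, and so avoids the isodiametric inequality.\<close>

lemma lborel_null_if_hausdorff_outer_eq_0:
  fixes N :: "'a::euclidean_space set"
  assumes N: "N \<in> sets borel" "hausdorff_outer DIM('a) N = 0"
  shows "N \<in> null_sets lborel"
proof -
  have "emeasure lborel N = 0"
  proof (rule ennreal_le_all_pos_mult_imp_zero)
    fix e :: real assume e: "0 < e"
    have "hausdorff_pre DIM('a) 1 N \<le> hausdorff_outer DIM('a) N"
      unfolding hausdorff_outer_def by (rule SUP_upper) simp
    then have "hausdorff_pre DIM('a) 1 N < ennreal e" using N(2) e by simp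
    then obtain C where C: "C \<in> hausdorff_covers 1 N"
      "(\<Sum>n. hausdorff_weight DIM('a) (C n)) < ennreal e"
      unfolding hausdorff_pre_def INF_less_iff by blast
    have bdd: "bounded (C n)" for n using C(1) by (simp add: hausdorff_covers_def)
    define B where "B n = (if C n = {} then {} else cball (SOME x. x \<in> C n) (diameter (C n)))" for n
    have sub: "C n \<subseteq> B n" for n
    proof (cases "C n = {}")
      case False
      then have "(SOME x. x \<in> C n) \<in> C n" by (simp add: some_in_eq)
      then show ?thesis
        using False diameter_bounded_bound[OF bdd] by (auto simp: B_def)
    qed simp
    have le: "emeasure lborel (B n) \<le> ennreal (2 ^ DIM('a)) * hausdorff_weight DIM('a) (C n)" for n
      using diameter_ge_0[OF bdd[of n]]
      by (simp add: B_def hausdorff_weight_def emeasure_cball ennreal_mult[symmetric]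
          power_divide)
    have "emeasure lborel N \<le> emeasure lborel (\<Union>n. B n)"
    proof (rule emeasure_mono)
      show "N \<subseteq> (\<Union>n. B n)" using C(1) sub by (fastforce simp: hausdorff_covers_def)
    qed (auto simp: B_def)
    also have "\<dots> \<le> (\<Sum>n. emeasure lborel (B n))"
      by (intro emeasure_subadditive_countably) (auto simp: B_def)
    also have "\<dots> \<le> (\<Sum>n. ennreal (2 ^ DIM('a)) * hausdorff_weight DIM('a) (C n))"
      by (intro suminf_le le) auto
    also have "\<dots> \<le> ennreal (2 ^ DIM('a)) * ennreal e"
      unfolding ennreal_suminf_cmult using C(2) by (intro mult_left_mono) auto
    finally show "emeasure lborel N \<le> ennreal (2 ^ DIM('a)) * ennreal e" .
  qed simp
  then show ?thesis using N(1) by (simp add: null_sets_def)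
qed

text \<open>Absolute continuity and singularity see the reference measure only through its null
  sets, so this lets Lebesgue measure stand in for Hausdorff measure in
  \<open>ac_part\<close>.\<close>

lemma null_sets_hausdorff_measure:
  "null_sets (hausdorff_measure DIM('a)) = null_sets (lborel :: 'a::euclidean_space measure)"
proof (intro set_eqI iffI)
  fix N :: "'a set"
  show "N \<in> null_sets lborel" if "N \<in> null_sets (hausdorff_measure DIM('a))"
    using that by (intro lborel_null_if_hausdorff_outer_eq_0)
      (auto simp: null_sets_def emeasure_hausdorff_measure)
  show "N \<in> null_sets (hausdorff_measure DIM('a))" if "N \<in> null_sets lborel"
    using hausdorff_outer_eq_0_if_lborel_null[OF that] that
    by (auto simp: null_sets_def emeasure_hausdorff_measure)
qed

text \<open>The two density lemmas are the two halves of the decomposition: \<open>\<nu>\<close> on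
  \<open>F\<close> does not charge null sets, and the complement of \<open>F\<close> is itself null.
  Uniqueness of the decomposition does the rest.\<close>

lemma ac_part_hausdorff:
  fixes \<nu> :: "'a::euclidean_space measure"
  assumes fin: "finite_measure \<nu>" and sets: "sets \<nu> = sets borel"
  shows "ac_part (hausdorff_measure DIM('a)) \<nu> = density \<nu> (indicator {y. lower_dens \<nu> y < top})"
proof (rule ac_part_eqI[OF fin])
  note [measurable] = borel_measurable_lower_dens[OF fin sets]
  define F where "F = {y. lower_dens \<nu> y < top}"
  have F: "F \<in> sets \<nu>" "- F \<in> sets \<nu>" unfolding F_def sets by measurable
  have dens: "emeasure (density \<nu> (indicator Q)) A = emeasure \<nu> (A \<inter> Q)"
    if "A \<in> sets \<nu>" "Q \<in> sets \<nu>" for A Q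
    using that by (subst emeasure_density) (auto simp: Int_commute simp flip: indicator_inter_arith)
  have "lebesgue_decomposition (hausdorff_measure DIM('a)) \<nu>
      (density \<nu> (indicator F)) (density \<nu> (indicator (- F)))"
    unfolding lebesgue_decomposition_def
  proof (intro conjI ballI)
    show "emeasure \<nu> A = emeasure (density \<nu> (indicator F)) A + emeasure (density \<nu> (indicator (- F))) A"
      if A: "A \<in> sets \<nu>" for A
      using plus_emeasure[of "A \<inter> F" \<nu> "A \<inter> - F"] A F
      by (simp add: dens Int_Un_distrib[symmetric] disjoint_iff)
    show "absolutely_continuous (hausdorff_measure DIM('a)) (density \<nu> (indicator F))"
      unfolding absolutely_continuous_def null_sets_hausdorff_measure
    proof
      fix N :: "'a set" assume N: "N \<in> null_sets lborel"
      moreover have "emeasure \<nu> (N \<inter> F) = 0"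
        using emeasure_finite_lower_dens_null[OF fin sets N] by (simp add: F_def Int_def)
      ultimately show "N \<in> null_sets (density \<nu> (indicator F))"
        using F sets dens[of N F] by (auto simp: null_sets_def)
    qed
    have "- F \<in> null_sets (hausdorff_measure DIM('a))"
      unfolding null_sets_hausdorff_measure using infinite_lower_dens_null_set[OF fin sets]
      by (simp add: F_def Collect_neg_eq[symmetric] not_less top_unique)
    then show "mutually_singular (hausdorff_measure DIM('a)) (density \<nu> (indicator (- F)))"
      unfolding mutually_singular_def using F
      by (intro bexI[of _ "- F"]) (auto simp: dens null_sets_def)
  qed simp_all
  then show "lebesgue_decomposition (hausdorff_measure DIM('a)) \<nu>
      (density \<nu> (indicator {y. lower_dens \<nu> y < top})) (density \<nu> (indicator (- F)))"
    by (simp add: F_def)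
qed (simp add: sets)

text \<open>Replaces a statement about a measure by one about a number, whose dependence on the
  parameter can be shown to be measurable.\<close>

lemma ac_part_hausdorff_nonzero_iff:
  fixes \<nu> :: "'a::euclidean_space measure"
  assumes fin: "finite_measure \<nu>" and sets: "sets \<nu> = sets borel"
  shows "ac_part (hausdorff_measure DIM('a)) \<nu> \<noteq> null_measure borel \<longleftrightarrow>
    emeasure \<nu> {y. lower_dens \<nu> y < top} \<noteq> 0"
proof -
  note [measurable] = borel_measurable_lower_dens[OF fin sets]
  define F where "F = {y. lower_dens \<nu> y < top}"
  have F: "F \<in> sets \<nu>" unfolding F_def sets by measurable
  have dens: "emeasure (density \<nu> (indicator F)) A = emeasure \<nu> (A \<inter> F)" if "A \<in> sets \<nu>" for A
    using that F by (subst emeasure_density) (auto simp: Int_commute simp flip: indicator_inter_arith)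
  have "density \<nu> (indicator F) = null_measure borel \<longleftrightarrow> emeasure \<nu> F = 0"
  proof
    assume "density \<nu> (indicator F) = null_measure borel"
    then show "emeasure \<nu> F = 0" using dens[OF F] by simp
  next
    assume 0: "emeasure \<nu> F = 0"
    show "density \<nu> (indicator F) = null_measure borel"
    proof (rule measure_eqI)
      fix A assume "A \<in> sets (density \<nu> (indicator F))"
      then have "emeasure (density \<nu> (indicator F)) A \<le> emeasure \<nu> F"
        using F by (simp add: dens emeasure_mono)
      then show "emeasure (density \<nu> (indicator F)) A = emeasure (null_measure borel) A"
        using 0 by simp
    qed (simp add: sets)
  qed
  then show ?thesis
    unfolding ac_part_hausdorff[OF fin sets] by (simp add: F_def)
qed

section \<open>Volume of sublevel sets of transversal maps\<close>

text \<open>Completes a map into \<open>real ^ 'm\<close> to a map of \<open>real ^ 'l\<close> into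
  itself by keeping the other coordinates, as in the proof of the submersion theorem. Meant for
  injective \<open>\<sigma>\<close>, since it goes through \<open>inv \<sigma>\<close>.\<close>

definition replace_coords :: "('m \<Rightarrow> 'l) \<Rightarrow> real ^ 'l \<Rightarrow> real ^ 'm \<Rightarrow> real ^ 'l" where
  "replace_coords \<sigma> v w = (\<chi> j. if j \<in> range \<sigma> then w $ inv \<sigma> j else v $ j)"

lemma replace_coords_diff:
  "replace_coords \<sigma> v w - replace_coords \<sigma> v' w' = replace_coords \<sigma> (v - v') (w - w')"
  by (simp add: replace_coords_def vec_eq_iff)

lemma bounded_linear_replace_coords:
  "bounded_linear (\<lambda>v. replace_coords \<sigma> v (A *v v))"
  unfolding linear_conv_bounded_linear[symmetric]
  by (rule linearI) (simp_all add: replace_coords_def vec_eq_iff algebra_simps)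

lemma norm_replace_coords_zero_le:
  fixes \<sigma> :: "'m::finite \<Rightarrow> 'l::finite"
  shows "norm (replace_coords \<sigma> 0 w) \<le> real CARD('l) * norm w"
proof -
  have "norm (replace_coords \<sigma> 0 w) \<le> (\<Sum>j\<in>UNIV. \<bar>replace_coords \<sigma> 0 w $ j\<bar>)"
    by (rule norm_le_l1_cart)
  also have "\<dots> \<le> (\<Sum>j\<in>(UNIV :: 'l set). norm w)"
    by (intro sum_mono) (auto simp: replace_coords_def component_le_norm_cart)
  finally show ?thesis by simp
qed

text \<open>A nonzero Gram determinant makes \<open>A\<close> right invertible, so some of its
  columns form a basis, and \<open>\<sigma>\<close> enumerates them. A vector in the kernel vanishes
  off \<open>range \<sigma>\<close> and gives a vanishing combination of these independent
  columns.\<close>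

lemma exists_injective_replace_coords:
  fixes A :: "real ^ 'l ^ 'm"
  assumes "det (A ** transpose A) \<noteq> 0"
  shows "\<exists>\<sigma>. inj \<sigma> \<and> (\<forall>v. replace_coords \<sigma> v (A *v v) = 0 \<longrightarrow> v = 0)"
proof -
  have "invertible (A ** transpose A)"
    using assms by (simp add: invertible_det_nz)
  then obtain B where "A ** transpose A ** B = mat 1"
    unfolding invertible_def by blast
  then have "\<exists>B. A ** B = mat 1" by (metis matrix_mul_assoc)
  then have sp: "span (columns A) = UNIV"
    by (simp add: matrix_right_invertible_span_columns span_vec_eq)
  obtain B where B: "B \<subseteq> columns A" "independent B" "columns A \<subseteq> span B" "card B = dim (columns A)"
    using basis_exists by blast
  have fin: "finite B" using B(2) by (rule independent_imp_finite)
  have "dim (columns A) = CARD('m)"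
    using sp by (metis dim_span dim_UNIV DIM_cart DIM_real mult.right_neutral)
  then obtain f where f: "bij_betw f (UNIV :: 'm set) B"
    using fin B(4) by (metis finite_same_card_bij finite_class.finite_UNIV)
  have "\<exists>j. column j A = f i" for i
  proof -
    have "f i \<in> columns A" using bij_betwE[OF f] B(1) by blast
    then show ?thesis unfolding columns_def by auto
  qed
  then obtain \<sigma> where \<sigma>: "\<And>i. column (\<sigma> i) A = f i" by metis
  have inj: "inj \<sigma>"
    using f \<sigma> by (metis bij_betw_def inj_on_def)
  have "v = 0" if v: "replace_coords \<sigma> v (A *v v) = 0" for v
  proof -
    have out: "v $ j = 0" if "j \<notin> range \<sigma>" for j
      using arg_cong[OF v, of "\<lambda>x. x $ j"] that by (simp add: replace_coords_def)
    have Av: "(A *v v) $ i = 0" for i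
      using arg_cong[OF v, of "\<lambda>x. x $ \<sigma> i"] inj by (simp add: replace_coords_def)
    define g where "g = inv_into UNIV f"
    have "0 = A *v v" by (simp add: vec_eq_iff Av)
    also have "\<dots> = (\<Sum>j\<in>UNIV. (v $ j) *\<^sub>R column j A)"
      by (simp add: matrix_mult_sum scalar_mult_eq_scaleR)
    also have "\<dots> = (\<Sum>j\<in>range \<sigma>. (v $ j) *\<^sub>R column j A)"
      by (intro sum.mono_neutral_right) (auto simp: out)
    also have "\<dots> = (\<Sum>i\<in>UNIV. (v $ \<sigma> i) *\<^sub>R f i)"
      using inj by (simp add: sum.reindex \<sigma>)
    also have "\<dots> = (\<Sum>b\<in>B. (v $ \<sigma> (g b)) *\<^sub>R b)"
      using f unfolding g_def
      by (subst sum.reindex_bij_betw[OF f, symmetric]) (auto simp: bij_betw_def)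
    finally have z: "(\<Sum>b\<in>B. (v $ \<sigma> (g b)) *\<^sub>R b) = 0" by simp
    have "v $ \<sigma> i = 0" for i
    proof -
      have "v $ \<sigma> (g (f i)) = 0"
        using independentD[OF B(2) fin subset_refl z] f by (auto simp: bij_betw_def)
      then show ?thesis using f by (simp add: g_def bij_betw_def)
    qed
    then show ?thesis using out by (auto simp: vec_eq_iff) (metis rangeE)
  qed
  then show ?thesis using inj by blast
qed

lemma norm_matrix_vector_mult_le:
  fixes A :: "real ^ 'l ^ 'm"
  shows "norm (A *v v) \<le> real (CARD('m) * CARD('l)) * norm A * norm v"
proof -
  have "norm (A *v v) \<le> onorm ((*v) A) * norm v"
    by (rule onorm) (simp add: linear_conv_bounded_linear[symmetric])
  also have "onorm ((*v) A) \<le> real CARD('m) * real CARD('l) * norm A"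
  proof (rule onorm_le_matrix_component)
    show "\<bar>A $ i $ j\<bar> \<le> norm A" for i j
      by (rule order_trans[OF component_le_norm_cart Finite_Cartesian_Product.norm_nth_le])
  qed
  finally show ?thesis by (simp add: mult_right_mono)
qed

text \<open>For fixed \<open>\<sigma>\<close> the lower bound survives, with half its constant, on a
  ball around each matrix. Finitely many such balls cover \<open>K\<close>, and a matrix takes the
  \<open>\<sigma>\<close> of the centre of its ball.\<close>

lemma uniform_injective_replace_coords:
  fixes K :: "(real ^ 'l ^ 'm) set"
  assumes "compact K" and det: "\<And>A. A \<in> K \<Longrightarrow> det (A ** transpose A) \<noteq> 0"
  obtains c where "0 < c"
    "\<And>A. A \<in> K \<Longrightarrow> \<exists>\<sigma>. inj \<sigma> \<and> (\<forall>v. c * norm v \<le> norm (replace_coords \<sigma> v (A *v v)))"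
proof -
  \<comment> \<open>A Lipschitz constant of the completed linear map in its matrix, for
    \<open>norm v = 1\<close>; it is the same for all \<open>\<sigma>\<close>.\<close>
  define L where "L = real CARD('l) * real (CARD('m) * CARD('l))"
  have L: "0 < L" by (simp add: L_def)
  have "\<exists>c \<sigma>. 0 < c \<and> inj \<sigma> \<and> (\<forall>v. c * norm v \<le> norm (replace_coords \<sigma> v (A *v v)))"
    if A: "A \<in> K" for A
  proof -
    obtain \<sigma> where \<sigma>: "inj \<sigma>" "\<And>v. replace_coords \<sigma> v (A *v v) = 0 \<Longrightarrow> v = 0"
      using exists_injective_replace_coords[OF det[OF A]] by blast
    have lin: "linear (\<lambda>v. replace_coords \<sigma> v (A *v v))"
      using bounded_linear_replace_coords by (rule bounded_linear.linear)
    then have "inj (\<lambda>v. replace_coords \<sigma> v (A *v v))"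
      unfolding linear_injective_0[OF lin] using \<sigma>(2) by blast
    from linear_inj_bounded_below_pos[OF lin this] show ?thesis
      using \<sigma>(1) by blast
  qed
  then obtain c \<sigma> where c: "\<And>A. A \<in> K \<Longrightarrow> 0 < c A" "\<And>A. A \<in> K \<Longrightarrow> inj (\<sigma> A)"
    and low: "\<And>A v. A \<in> K \<Longrightarrow> c A * norm v \<le> norm (replace_coords (\<sigma> A) v (A *v v))"
    by metis
  have near: "c A / 2 * norm v \<le> norm (replace_coords (\<sigma> A) v (A' *v v))"
    if A: "A \<in> K" and A': "A' \<in> ball A (c A / (2 * L))" for A A' v
  proof -
    have "norm (replace_coords (\<sigma> A) v (A *v v) - replace_coords (\<sigma> A) v (A' *v v))
        \<le> real CARD('l) * norm ((A - A') *v v)"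
      unfolding replace_coords_diff using norm_replace_coords_zero_le[of "\<sigma> A" "A *v v - A' *v v"]
      by (simp add: matrix_vector_mult_diff_rdistrib)
    also have "\<dots> \<le> real CARD('l) * (real (CARD('m) * CARD('l)) * norm (A - A') * norm v)"
      by (intro mult_left_mono norm_matrix_vector_mult_le) auto
    also have "\<dots> = L * norm (A - A') * norm v" by (simp add: L_def)
    also have "\<dots> \<le> c A / 2 * norm v"
      using A' L by (intro mult_right_mono) (auto simp: dist_norm field_simps)
    finally show ?thesis
      using low[OF A, of v] norm_triangle_ineq2[of "replace_coords (\<sigma> A) v (A *v v)" "replace_coords (\<sigma> A) v (A' *v v)"]
      by linarith
  qed
  have "K \<subseteq> (\<Union>A\<in>K. ball A (c A / (2 * L)))" using c(1) L by force
  then obtain F where F: "F \<subseteq> K" "finite F" "K \<subseteq> (\<Union>A\<in>F. ball A (c A / (2 * L)))"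
    using compactE_image[OF \<open>compact K\<close>, of K "\<lambda>A. ball A (c A / (2 * L))"] by blast
  \<comment> \<open>The inserted 1 keeps the minimum meaningful when \<open>F\<close> is
    empty.\<close>
  define c0 where "c0 = Min (insert 1 ((\<lambda>A. c A / 2) ` F))"
  show ?thesis
  proof
    show "0 < c0" using F c(1) by (auto simp: c0_def)
    fix A' assume "A' \<in> K"
    then obtain A where A: "A \<in> F" "A' \<in> ball A (c A / (2 * L))" using F(3) by blast
    have "c0 \<le> c A / 2" unfolding c0_def using A F(2) by (intro Min_le) auto
    then have "c0 * norm v \<le> norm (replace_coords (\<sigma> A) v (A' *v v))" for v
      using near[of A A' v] A F(1) mult_right_mono[of c0 "c A / 2" "norm v"] by fastforce
    then show "\<exists>\<sigma>. inj \<sigma> \<and> (\<forall>v. c0 * norm v \<le> norm (replace_coords \<sigma> v (A' *v v)))"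
      using c(2) A(1) F(1) by blast
  qed
qed

section \<open>Jacobian matrices, linearisation and the slab estimate\<close>

lemma jacobian_mult_eq_Deriv:
  fixes T :: "real ^ 'l \<Rightarrow> real ^ 'm"
  assumes "T differentiable (at u)"
  shows "jacobian T (at u) *v h = blinfun_apply (Deriv T u) h"
proof -
  have "bounded_linear (frechet_derivative T (at u))"
    using assms by (simp add: frechet_derivative_works has_derivative_bounded_linear)
  then show ?thesis
    unfolding jacobian_def Deriv_def
    by (metis bounded_linear_Blinfun_apply matrix_vector_mul(3))
qed

lemma norm_jacobian_le:
  fixes T :: "real ^ 'l \<Rightarrow> real ^ 'm"
  assumes "T differentiable (at u)"
  shows "norm (jacobian T (at u)) \<le> real (CARD('m) * CARD('l)) * norm (Deriv T u)"
proof -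
  let ?A = "jacobian T (at u)"
  have ent: "\<bar>?A $ i $ j\<bar> \<le> norm (Deriv T u)" for i j
  proof -
    have "?A $ i $ j = (?A *v axis j 1) $ i"
      by (simp add: matrix_vector_mult_basis column_def)
    also have "\<bar>\<dots>\<bar> \<le> norm (blinfun_apply (Deriv T u) (axis j 1))"
      unfolding jacobian_mult_eq_Deriv[OF assms] by (rule component_le_norm_cart)
    also have "\<dots> \<le> norm (Deriv T u) * norm (axis j 1 :: real ^ 'l)" by (rule norm_blinfun)
    finally show ?thesis by (simp add: norm_axis_1)
  qed
  have "norm ?A \<le> (\<Sum>i\<in>UNIV. norm (?A $ i))"
    unfolding norm_vec_def by (rule L2_set_le_sum) simp
  also have "\<dots> \<le> (\<Sum>i\<in>(UNIV::'m set). \<Sum>j\<in>(UNIV::'l set). norm (Deriv T u))"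
    by (intro sum_mono order_trans[OF norm_le_l1_cart] ent)
  finally show ?thesis by simp
qed

text \<open>The mean value inequality is used twice: for \<open>Deriv T\<close>, and then for
  \<open>T\<close> minus its linear part at \<open>u0\<close>. The factor \<open>2 * s\<close> is
  the diameter of the ball, as \<open>u0\<close> need not be its centre.\<close>

lemma norm_linearization_error_le:
  fixes T :: "real ^ 'l \<Rightarrow> real ^ 'm"
  assumes T: "\<And>u. u \<in> cball a s \<Longrightarrow> T differentiable (at u)"
    "\<And>u. u \<in> cball a s \<Longrightarrow> Deriv T differentiable (at u)"
    "\<And>u. u \<in> cball a s \<Longrightarrow> norm (Deriv (Deriv T) u) \<le> K" "0 \<le> s"
    and u: "u0 \<in> cball a s" "u \<in> cball a s" "v \<in> cball a s"
  shows "norm (T u - T v - blinfun_apply (Deriv T u0) (u - v)) \<le> 2 * s * K * norm (u - v)"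
proof -
  have D: "norm (Deriv T w - Deriv T u0) \<le> 2 * s * K" if w: "w \<in> cball a s" for w
  proof -
    have K: "0 \<le> K" using T(3)[OF u(1)] norm_ge_zero order_trans by blast
    have "norm (Deriv T w - Deriv T u0) \<le> K * norm (w - u0)"
    proof (rule differentiable_bound[where S="cball a s" and f'="\<lambda>w. blinfun_apply (Deriv (Deriv T) w)"])
      show "(Deriv T has_derivative blinfun_apply (Deriv (Deriv T) x)) (at x within cball a s)"
        if "x \<in> cball a s" for x
        using has_derivative_Deriv[OF T(2)[OF that]] by (rule has_derivative_at_withinI)
      show "onorm (blinfun_apply (Deriv (Deriv T) x)) \<le> K" if "x \<in> cball a s" for x
        using T(3)[OF that] by (simp add: norm_blinfun.rep_eq)
    qed (use w u in auto)
    also have "norm (w - u0) \<le> 2 * s"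
      using w u(1) dist_triangle2[of w u0 a] by (auto simp: dist_norm[symmetric] dist_commute)
    then have "K * norm (w - u0) \<le> 2 * s * K" using K by (simp add: mult.commute mult_left_mono)
    finally show ?thesis .
  qed
  define g where "g w = T w - blinfun_apply (Deriv T u0) w" for w
  have "norm (g u - g v) \<le> 2 * s * K * norm (u - v)"
  proof (rule differentiable_bound[where S="cball a s" and
        f'="\<lambda>w. blinfun_apply (Deriv T w - Deriv T u0)"])
    show "(g has_derivative blinfun_apply (Deriv T x - Deriv T u0)) (at x within cball a s)"
      if "x \<in> cball a s" for x
      unfolding g_def minus_blinfun.rep_eq
      by (intro has_derivative_diff has_derivative_at_withinI[OF has_derivative_Deriv[OF T(1)[OF that]]]
          bounded_linear.has_derivative[OF blinfun.bounded_linear_right] has_derivative_ident)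
    show "onorm (blinfun_apply (Deriv T x - Deriv T u0)) \<le> 2 * s * K" if "x \<in> cball a s" for x
      using D[OF that] by (simp add: norm_blinfun.rep_eq)
  qed (use u in auto)
  then show ?thesis by (simp add: g_def blinfun.diff_right algebra_simps)
qed


lemma continuous_det_mult_transpose:
  "continuous_on S (\<lambda>A :: real ^ 'l ^ 'm. det (A ** transpose A))"
  unfolding det_def matrix_matrix_mult_def transpose_def
  by (simp, intro continuous_intros)

lemma emeasure_coordinate_slab_le:
  fixes \<sigma> :: "'m::finite \<Rightarrow> 'l::finite" and a :: "real ^ 'l"
  assumes "inj \<sigma>" "0 < \<rho>" "1 \<le> W"
  shows "emeasure lborel {y. \<forall>j. if j \<in> range \<sigma> then \<bar>y $ j\<bar> \<le> 2 * \<rho> else \<bar>y $ j - a $ j\<bar> \<le> W / 2}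
    \<le> ennreal (4 ^ CARD('m) * W ^ CARD('l) * \<rho> ^ CARD('m))"
proof -
  define p where "p = (\<chi> j. if j \<in> range \<sigma> then - 2 * \<rho> else a $ j - W / 2)"
  define q where "q = (\<chi> j. if j \<in> range \<sigma> then 2 * \<rho> else a $ j + W / 2)"
  have eq: "{y. \<forall>j. if j \<in> range \<sigma> then \<bar>y $ j\<bar> \<le> 2 * \<rho> else \<bar>y $ j - a $ j\<bar> \<le> W / 2} = cbox p q"
  proof -
    have "(if j \<in> range \<sigma> then \<bar>y $ j\<bar> \<le> 2 * \<rho> else \<bar>y $ j - a $ j\<bar> \<le> W / 2) \<longleftrightarrow> p $ j \<le> y $ j \<and> y $ j \<le> q $ j"
      for y j
      by (simp add: p_def q_def abs_le_iff) argo
    then show ?thesis by (auto simp: mem_box_cart)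
  qed
  have pq: "p $ j \<le> q $ j" for j using assms by (simp add: p_def q_def)
  have "measure lborel (cbox p q) = (\<Prod>j\<in>UNIV. q $ j - p $ j)"
  proof (rule content_cbox_cart)
    have "p \<in> cbox p q" using pq by (simp add: mem_box_cart)
    then show "cbox p q \<noteq> {}" by blast
  qed
  also have "\<dots> = (\<Prod>j\<in>UNIV. if j \<in> range \<sigma> then 4 * \<rho> else W)"
    by (intro prod.cong) (auto simp: p_def q_def)
  also have "\<dots> = (4 * \<rho>) ^ CARD('m) * W ^ card (- range \<sigma>)"
    using assms(1) by (simp add: prod.If_cases card_image)
  \<comment> \<open>\<open>1 \<le> W\<close> allows the exponent to be raised to
    \<open>CARD('l)\<close>, which spares computing the number of kept coordinates.\<close>
  also have "\<dots> \<le> (4 * \<rho>) ^ CARD('m) * W ^ CARD('l)"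
    using assms by (intro mult_left_mono power_increasing card_mono) auto
  finally have "measure lborel (cbox p q) \<le> 4 ^ CARD('m) * W ^ CARD('l) * \<rho> ^ CARD('m)"
    by (simp add: power_mult_distrib ac_simps)
  moreover have "emeasure lborel (cbox p q) = ennreal (measure lborel (cbox p q))"
    using emeasure_lborel_cbox_finite[of p q] by (intro emeasure_eq_ennreal_measure) auto
  ultimately show ?thesis
    unfolding eq by (simp only: ennreal_leI)
qed

text \<open>What the volume estimate uses of a single difference quotient; \<open>C\<close> and
  \<open>K\<close> will be shared by all pairs of points, so that the estimate is uniform.\<close>

definition transversal_on :: "(real ^ 'l) set \<Rightarrow> real \<Rightarrow> real \<Rightarrow> (real ^ 'l \<Rightarrow> real ^ 'm) \<Rightarrow> bool" where
  "transversal_on B C K T \<longleftrightarrow> (\<forall>u\<in>B. T differentiable (at u) \<and> Deriv T differentiable (at u) \<and>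
     norm (Deriv T u) \<le> K \<and> norm (Deriv (Deriv T) u) \<le> K \<and>
     (norm (T u) \<le> C \<longrightarrow> C \<le> \<bar>jacobian_det T u\<bar>))"

text \<open>Replacing \<open>m\<close> suitable coordinates of \<open>u\<close> by \<open>T u\<close> gives an expanding map which sends the
  sublevel set of \<open>T\<close> into a slab; the choice of coordinates is uniform by compactness.\<close>

lemma transversal_sublevel_volume:
  assumes C': "0 < C'" and K: "0 < K"
  obtains s0 M where "0 < s0"
    "\<And>(T :: real ^ 'l \<Rightarrow> real ^ 'm) a s \<rho>.
      transversal_on (cball a s) C' K T \<Longrightarrow>
      0 < s \<Longrightarrow> s \<le> s0 \<Longrightarrow> 0 < \<rho> \<Longrightarrow> \<rho> \<le> C' \<Longrightarrow>
      emeasure lborel {u \<in> cball a s. norm (T u) \<le> \<rho>} \<le> ennreal (M * \<rho> ^ CARD('m))"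
proof -
  define L where "L = real CARD('l)"
  have L: "0 < L" by (simp add: L_def)
  \<comment> \<open>A compact set containing every Jacobian matrix that can occur where
    \<open>norm (T u) \<le> C'\<close>; the square appears because \<open>jacobian_det\<close> is a
    square root.\<close>
  define \<K> :: "(real ^ 'l ^ 'm) set" where "\<K> = cball 0 (real (CARD('m) * CARD('l)) * K) \<inter>
      {A. C'\<^sup>2 \<le> \<bar>det (A ** transpose A)\<bar>}"
  have "closed {A :: real ^ 'l ^ 'm. C'\<^sup>2 \<le> \<bar>det (A ** transpose A)\<bar>}"
    by (intro closed_Collect_le continuous_intros continuous_det_mult_transpose)
  then have "compact \<K>"
    unfolding \<K>_def by (intro compact_Int_closed) auto
  moreover have "det (A ** transpose A) \<noteq> 0" if "A \<in> \<K>" for A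
    using that C' by (auto simp: \<K>_def)
  ultimately obtain c where c: "0 < c"
    and low: "\<And>A. A \<in> \<K> \<Longrightarrow> \<exists>\<sigma>. inj \<sigma> \<and> (\<forall>v. c * norm v \<le> norm (replace_coords \<sigma> v (A *v v)))"
    using uniform_injective_replace_coords by metis
  \<comment> \<open>On balls of radius \<open>s0\<close> the linearisation error, at most
    \<open>L * (2 * s0 * K) = c / 2\<close> per unit length, uses up only half of the expansion
    \<open>c\<close>.\<close>
  define s0 where "s0 = c / (4 * L * K)"
  have s0: "0 < s0" using c L K by (simp add: s0_def)
  \<comment> \<open>Kept coordinates stay within \<open>s0\<close> of those of \<open>a\<close>, and
    the neighbourhood of the image adds at most \<open>C'\<close>.\<close>
  define W where "W = max 1 (2 * (s0 + C'))"
  define M where "M = (10 / c) ^ CARD('l) * (4 ^ CARD('m) * W ^ CARD('l))"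
  show ?thesis
  proof (rule that[OF s0, of M])
    fix T :: "real ^ 'l \<Rightarrow> real ^ 'm" and a s \<rho>
    assume tr: "transversal_on (cball a s) C' K T"
      and s: "0 < s" "s \<le> s0" and \<rho>: "0 < \<rho>" "\<rho> \<le> C'"
    have T: "\<And>u. u \<in> cball a s \<Longrightarrow> T differentiable (at u)"
      "\<And>u. u \<in> cball a s \<Longrightarrow> Deriv T differentiable (at u)"
      "\<And>u. u \<in> cball a s \<Longrightarrow> norm (Deriv T u) \<le> K"
      "\<And>u. u \<in> cball a s \<Longrightarrow> norm (Deriv (Deriv T) u) \<le> K"
      "\<And>u. u \<in> cball a s \<Longrightarrow> norm (T u) \<le> C' \<Longrightarrow> C' \<le> \<bar>jacobian_det T u\<bar>"
      using tr by (simp_all add: transversal_on_def)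
    define E where "E = {u \<in> cball a s. norm (T u) \<le> \<rho>}"
    have contT: "continuous_on (cball a s) T"
      using T(1) by (meson continuous_at_imp_continuous_on differentiable_imp_continuous_within)
    have "E = cball a s \<inter> T -` cball 0 \<rho>" by (auto simp: E_def)
    then have "closed E"
      using continuous_closed_preimage[OF contT closed_cball closed_cball] by metis
    show "emeasure lborel E \<le> ennreal (M * \<rho> ^ CARD('m))"
    proof (cases "E = {}")
      case False
      then obtain u0 where u0: "u0 \<in> E" by blast
      \<comment> \<open>The Jacobian is controlled only where \<open>T\<close> is small, so the
        linearisation is taken at a point of the sublevel set and not at the centre
        \<open>a\<close>. This one matrix fixes \<open>\<sigma>\<close> for the whole ball.\<close>
      define A where "A = jacobian T (at u0)"
      have u0': "u0 \<in> cball a s" "norm (T u0) \<le> C'" using u0 \<rho> by (auto simp: E_def)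
      have "C'\<^sup>2 \<le> \<bar>det (A ** transpose A)\<bar>"
      proof -
        have "C'\<^sup>2 \<le> \<bar>jacobian_det T u0\<bar>\<^sup>2"
          using T(5)[OF u0'] C' by (intro power_mono) auto
        also have "\<dots> \<le> \<bar>det (A ** transpose A)\<bar>"
          unfolding jacobian_det_def A_def[symmetric] by (simp add: sqrt_def real_root_abs[symmetric])
        finally show ?thesis .
      qed
      moreover have "norm A \<le> real (CARD('m) * CARD('l)) * K"
        unfolding A_def
        by (rule order_trans[OF norm_jacobian_le[OF T(1)[OF u0'(1)]]])
          (intro mult_left_mono T(3) u0'(1), simp)
      ultimately have "A \<in> \<K>" by (simp add: \<K>_def)
      from low[OF this] obtain \<sigma> where \<sigma>: "inj \<sigma>"
        "\<And>v. c * norm v \<le> norm (replace_coords \<sigma> v (A *v v))" by blast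
      define F where "F u = replace_coords \<sigma> u (T u)" for u
      \<comment> \<open>In \<open>2 * \<rho>\<close>, one \<open>\<rho>\<close> bounds
        \<open>T\<close> and the other is the radius of the packed balls.\<close>
      define G where "G = {y. \<forall>j. if j \<in> range \<sigma> then \<bar>y $ j\<bar> \<le> 2 * \<rho> else \<bar>y $ j - a $ j\<bar> \<le> W / 2}"
      have "emeasure lborel E \<le> ennreal ((5 / (c / 2)) ^ DIM(real ^ 'l)) * emeasure lborel G"
      proof (rule emeasure_expanding_preimage_le[where F=F and r=\<rho>])
        show "E \<in> sets borel" using \<open>closed E\<close> by simp
        have "continuous_on E T" using contT by (rule continuous_on_subset) (auto simp: E_def)
        show "continuous_on E F"
          unfolding F_def replace_coords_def
        proof (rule continuous_on_vec_lambda)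
          show "continuous_on E (\<lambda>u. if j \<in> range \<sigma> then T u $ inv \<sigma> j else u $ j)" for j
            using \<open>continuous_on E T\<close>
            by (cases "j \<in> range \<sigma>") (auto intro!: continuous_intros)
        qed
        show "0 < c / 2" using c by simp
        show "0 < \<rho>" by fact
        show "G \<in> sets borel"
        proof -
          have "G = (\<Inter>j. {y. (if j \<in> range \<sigma> then \<bar>y $ j\<bar> \<le> 2 * \<rho> else \<bar>y $ j - a $ j\<bar> \<le> W / 2)})"
            by (auto simp: G_def)
          moreover have "closed {y. (if j \<in> range \<sigma> then \<bar>y $ j\<bar> \<le> 2 * \<rho> else \<bar>y $ j - a $ j\<bar> \<le> W / 2)}" for j
            by (cases "j \<in> range \<sigma>") (auto intro!: closed_Collect_le continuous_intros)
          ultimately show ?thesis by auto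
        qed
        show "cball (F u) \<rho> \<subseteq> G" if u: "u \<in> E" for u
        proof
          fix y assume "y \<in> cball (F u) \<rho>"
          then have y: "\<bar>y $ j - F u $ j\<bar> \<le> \<rho>" for j
            using component_le_norm_cart[of "y - F u" j] by (simp add: dist_norm norm_minus_commute)
          have Tu: "\<bar>T u $ i\<bar> \<le> \<rho>" for i
            using u component_le_norm_cart[of "T u" i] by (simp add: E_def)
          have ua: "\<bar>u $ j - a $ j\<bar> \<le> s" for j
            using u component_le_norm_cart[of "u - a" j] by (simp add: E_def dist_norm norm_minus_commute)
          have W: "s + \<rho> \<le> W / 2" using s \<rho> by (simp add: W_def)
          show "y \<in> G"
            unfolding G_def
          proof (intro CollectI allI)
            fix j
            show "if j \<in> range \<sigma> then \<bar>y $ j\<bar> \<le> 2 * \<rho> else \<bar>y $ j - a $ j\<bar> \<le> W / 2"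
            proof (cases "j \<in> range \<sigma>")
              case True
              then have "F u $ j = T u $ inv \<sigma> j" by (simp add: F_def replace_coords_def)
              then have "\<bar>y $ j\<bar> \<le> 2 * \<rho>" using y[of j] Tu[of "inv \<sigma> j"] by linarith
              with True show ?thesis by simp
            next
              case False
              then have "F u $ j = u $ j" by (simp add: F_def replace_coords_def)
              then have "\<bar>y $ j - a $ j\<bar> \<le> W / 2" using y[of j] ua[of j] W by linarith
              with False show ?thesis by simp
            qed
          qed
        qed
        show "c / 2 * dist u v \<le> dist (F u) (F v)" if uv: "u \<in> E" "v \<in> E" for u v
        proof -
          let ?d = "T u - T v - A *v (u - v)"
          have "F u - F v - replace_coords \<sigma> (u - v) (A *v (u - v)) = replace_coords \<sigma> 0 ?d"
            by (simp add: F_def replace_coords_diff)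
          then have "norm (F u - F v - replace_coords \<sigma> (u - v) (A *v (u - v))) \<le> L * norm ?d"
            using norm_replace_coords_zero_le[of \<sigma> ?d] by (simp add: L_def)
          also have "norm ?d \<le> 2 * s * K * norm (u - v)"
            unfolding A_def jacobian_mult_eq_Deriv[OF T(1)[OF u0'(1)]]
            by (rule norm_linearization_error_le[OF T(1,2,4)]) (use uv u0' s in \<open>auto simp: E_def\<close>)
          then have "L * norm ?d \<le> L * (2 * s * K * norm (u - v))"
            using L by (intro mult_left_mono) auto
          also have "\<dots> = s * (2 * L * K) * norm (u - v)" by simp
          also have "\<dots> \<le> s0 * (2 * L * K) * norm (u - v)"
            using s L K by (intro mult_right_mono) auto
          also have "s0 * (2 * L * K) = c / 2"
            using L K by (simp add: s0_def field_simps)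
          finally have "norm (F u - F v - replace_coords \<sigma> (u - v) (A *v (u - v))) \<le> c / 2 * norm (u - v)" .
          then show ?thesis
            using \<sigma>(2)[of "u - v"] norm_triangle_ineq2[of "replace_coords \<sigma> (u - v) (A *v (u - v))" "F u - F v"]
            by (simp add: dist_norm norm_minus_commute)
        qed
      qed
      also have "\<dots> \<le> ennreal ((10 / c) ^ CARD('l)) * ennreal (4 ^ CARD('m) * W ^ CARD('l) * \<rho> ^ CARD('m))"
        unfolding G_def
        using emeasure_coordinate_slab_le[OF \<sigma>(1) \<rho>(1), of W a]
        by (intro mult_mono) (auto simp: W_def)
      also have "\<dots> = ennreal (M * \<rho> ^ CARD('m))"
        using c \<rho> by (simp add: M_def W_def ennreal_mult[symmetric] ac_simps)
      finally show ?thesis .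
    qed simp
  qed
qed

section \<open>Transversal families\<close>

lemma Deriv_eqI: "(f has_derivative blinfun_apply D) (at u) \<Longrightarrow> Deriv f u = D"
  unfolding Deriv_def by (metis frechet_derivative_at blinfun_apply_inverse)

lemma has_derivative_diff_quot:
  fixes P :: "'x::metric_space \<Rightarrow> real ^ 'l \<Rightarrow> real ^ 'm"
  assumes "P x differentiable (at u)" "P x' differentiable (at u)"
  shows "(diff_quot P x x' has_derivative
    blinfun_apply ((Deriv (P x) u - Deriv (P x') u) /\<^sub>R dist x x')) (at u)"
  unfolding diff_quot_def[abs_def] scaleR_blinfun.rep_eq minus_blinfun.rep_eq
  by (intro has_derivative_scaleR_right has_derivative_diff has_derivative_Deriv assms)

lemma Deriv_diff_quot:
  fixes P :: "'x::metric_space \<Rightarrow> real ^ 'l \<Rightarrow> real ^ 'm"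
  assumes "P x differentiable (at u)" "P x' differentiable (at u)"
  shows "Deriv (diff_quot P x x') u = (Deriv (P x) u - Deriv (P x') u) /\<^sub>R dist x x'"
  by (rule Deriv_eqI[OF has_derivative_diff_quot[OF assms]])

text \<open>The formula for the first derivative is known on \<open>\<Lambda>\<close> only; openness
  lets it be differentiated once more.\<close>

lemma Deriv_diff_quot_differentiable:
  fixes P :: "'x::metric_space \<Rightarrow> real ^ 'l \<Rightarrow> real ^ 'm"
  assumes C2: "\<And>x. C2_on \<Lambda> (P x)" and \<Lambda>: "open \<Lambda>" "u \<in> \<Lambda>"
  shows "Deriv (diff_quot P x x') differentiable (at u)"
proof -
  have D: "P y differentiable (at v)" "Deriv (P y) differentiable (at v)" if "v \<in> \<Lambda>" for y v
    using C2[of y] that by (auto simp: C2_on_def)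
  have "(\<lambda>v. (Deriv (P x) v - Deriv (P x') v) /\<^sub>R dist x x') differentiable (at u)"
    by (intro differentiable_scaleR differentiable_diff D \<Lambda> differentiable_const)
  then obtain D' where D': "((\<lambda>v. (Deriv (P x) v - Deriv (P x') v) /\<^sub>R dist x x') has_derivative D') (at u)"
    by (auto simp: differentiable_def)
  have "(Deriv (diff_quot P x x') has_derivative D') (at u)"
    by (rule has_derivative_transform_within_open[OF D' \<Lambda>]) (simp add: Deriv_diff_quot D)
  then show ?thesis by (auto simp: differentiable_def)
qed

lemma jacobian_diff_quot:
  fixes P :: "'x::metric_space \<Rightarrow> real ^ 'l \<Rightarrow> real ^ 'm"
  assumes D: "P x differentiable (at u)" "P x' differentiable (at u)"
  shows "jacobian (diff_quot P x x') (at u) = (jacobian (P x) (at u) - jacobian (P x') (at u)) /\<^sub>R dist x x'"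
proof -
  have T: "diff_quot P x x' differentiable (at u)"
    using has_derivative_diff_quot[OF D] by (auto simp: differentiable_def)
  have "jacobian (diff_quot P x x') (at u) *v h
      = ((jacobian (P x) (at u) - jacobian (P x') (at u)) /\<^sub>R dist x x') *v h" for h
    unfolding jacobian_mult_eq_Deriv[OF T] Deriv_diff_quot[OF D]
    by (simp add: scaleR_matrix_vector_assoc[symmetric] matrix_vector_mult_diff_rdistrib
        jacobian_mult_eq_Deriv[OF D(1)] jacobian_mult_eq_Deriv[OF D(2)] blinfun.diff_left blinfun.scaleR_left)
  then show ?thesis by (simp add: matrix_eq)
qed

text \<open>The Gram determinant is continuous and vanishes at the zero matrix. Under
  transversality, a difference quotient therefore cannot be small together with its
  derivative.\<close>

lemma small_jacobian_det:
  assumes "0 < C"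
  obtains d where "0 < d"
    "\<And>(f :: real ^ 'l \<Rightarrow> real ^ 'm) u. norm (jacobian f (at u)) < d \<Longrightarrow> \<bar>jacobian_det f u\<bar> < C"
proof -
  let ?h = "\<lambda>A :: real ^ 'l ^ 'm. sqrt (det (A ** transpose A))"
  \<comment> \<open>Any row will do; index types are nonempty.\<close>
  have "row undefined (0 :: real ^ 'm ^ 'm) = 0" by (simp add: row_def vec_eq_iff)
  then have "det (0 :: real ^ 'm ^ 'm) = 0" by (rule det_zero_row)
  then have h0: "?h 0 = 0" by simp
  have "continuous_on UNIV ?h"
    by (intro continuous_on_real_sqrt continuous_det_mult_transpose)
  then have "isCont ?h 0" by (simp add: continuous_on_eq_continuous_at)
  then obtain d where d: "0 < d" "\<And>A. dist A 0 < d \<Longrightarrow> dist (?h A) (?h 0) < C"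
    using assms unfolding continuous_at_eps_delta by blast
  show ?thesis
  proof (rule that[OF d(1)])
    fix f :: "real ^ 'l \<Rightarrow> real ^ 'm" and u assume "norm (jacobian f (at u)) < d"
    then show "\<bar>jacobian_det f u\<bar> < C"
      using d(2)[of "jacobian f (at u)"] unfolding h0 jacobian_det_def by simp
  qed
qed

lemma transversal_family_bounds:
  fixes P :: "'x::metric_space \<Rightarrow> real ^ 'l \<Rightarrow> real ^ 'm"
  assumes tr: "transversal_family \<Lambda> P"
  obtains C' K where "0 < C'" "0 < K"
    "\<And>u x x'. u \<in> \<Lambda> \<Longrightarrow> x \<noteq> x' \<Longrightarrow> norm (diff_quot P x x' u) \<le> C' \<Longrightarrow>
      C' \<le> \<bar>jacobian_det (diff_quot P x x') u\<bar>"
    "\<And>u x x'. u \<in> \<Lambda> \<Longrightarrow> x \<noteq> x' \<Longrightarrow> norm (Deriv (diff_quot P x x') u) \<le> K"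
    "\<And>u x x'. u \<in> \<Lambda> \<Longrightarrow> x \<noteq> x' \<Longrightarrow> norm (Deriv (Deriv (diff_quot P x x')) u) \<le> K"
proof -
  have 1: "\<exists>C'>0. \<forall>u\<in>\<Lambda>. \<forall>x x'. x \<noteq> x' \<longrightarrow> norm (diff_quot P x x' u) \<le> C' \<longrightarrow>
      \<bar>jacobian_det (diff_quot P x x') u\<bar> \<ge> C'"
    using tr unfolding transversal_family_def by (elim conjE)
  have 2: "\<exists>K>0. \<forall>u\<in>\<Lambda>. \<forall>x x'. x \<noteq> x' \<longrightarrow> norm (Deriv (diff_quot P x x') u) \<le> K \<and>
      norm (Deriv (Deriv (diff_quot P x x')) u) \<le> K"
    using tr unfolding transversal_family_def by (elim conjE)
  show ?thesis
    using 1 2 that by metis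
qed

text \<open>At a fixed parameter, a point is determined by its image together with the Jacobian there,
  and the inverse of this map into a Euclidean space is Lipschitz.\<close>

lemma transversal_family_separable:
  fixes P :: "'x::metric_space \<Rightarrow> real ^ 'l \<Rightarrow> real ^ 'm"
  assumes tr: "transversal_family \<Lambda> P" and u: "u \<in> \<Lambda>"
  obtains D :: "'x set" where "countable D" "\<forall>x. \<forall>e>0. \<exists>d\<in>D. dist d x < e"
proof -
  obtain C' where C': "0 < C'" and J: "\<And>x x'. x \<noteq> x' \<Longrightarrow>
      norm (diff_quot P x x' u) \<le> C' \<Longrightarrow> C' \<le> \<bar>jacobian_det (diff_quot P x x') u\<bar>"
    using transversal_family_bounds[OF tr] u by metis
  have D: "P x differentiable (at u)" for x
    using tr u by (auto simp: transversal_family_def C2_on_def)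
  obtain d where d: "0 < d"
    "\<And>(f :: real ^ 'l \<Rightarrow> real ^ 'm) u. norm (jacobian f (at u)) < d \<Longrightarrow> \<bar>jacobian_det f u\<bar> < C'"
    using small_jacobian_det[OF C'] by metis
  define \<Phi> where "\<Phi> x = (P x u, jacobian (P x) (at u))" for x
  \<comment> \<open>If \<open>\<Phi>\<close> moved by less than \<open>c * dist x x'\<close>, the
    difference quotient would be at most \<open>C'\<close> and its Jacobian matrix below
    \<open>d\<close>, a contradiction.\<close>
  define c where "c = min C' d"
  have c: "0 < c" using C' d by (simp add: c_def)
  have lip: "c * dist x x' \<le> dist (\<Phi> x) (\<Phi> x')" for x x'
  proof (rule ccontr)
    assume "\<not> ?thesis"
    then have lt: "dist (\<Phi> x) (\<Phi> x') < c * dist x x'" by simp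
    then have ne: "x \<noteq> x'" by auto
    have "norm (P x u - P x' u) \<le> dist (\<Phi> x) (\<Phi> x')"
      using norm_fst_le[of "P x u - P x' u" "jacobian (P x) (at u) - jacobian (P x') (at u)"]
      by (simp add: \<Phi>_def dist_norm)
    with lt ne have 1: "norm (diff_quot P x x' u) \<le> C'"
      by (simp add: diff_quot_def c_def divide_simps mult.commute)
        (smt (verit) mult_right_mono zero_le_dist)
    have "norm (jacobian (P x) (at u) - jacobian (P x') (at u)) \<le> dist (\<Phi> x) (\<Phi> x')"
      using norm_snd_le[of "jacobian (P x) (at u) - jacobian (P x') (at u)" "P x u - P x' u"]
      by (simp add: \<Phi>_def dist_norm)
    with lt have "norm (jacobian (P x) (at u) - jacobian (P x') (at u)) < c * dist x x'" by simp
    also have "\<dots> \<le> d * dist x x'" by (intro mult_right_mono) (auto simp: c_def)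
    finally have "norm (jacobian (diff_quot P x x') (at u)) < d"
      using ne by (simp add: jacobian_diff_quot[OF D D] divide_simps)
    from d(2)[OF this] J[OF ne 1] show False by simp
  qed
  obtain Q where Q: "countable Q" "Q \<subseteq> range \<Phi>" "range \<Phi> \<subseteq> closure Q"
    using separable by metis
  show ?thesis
  proof
    show "countable (inv \<Phi> ` Q)" using Q by simp
    show "\<forall>x. \<forall>e>0. \<exists>d\<in>inv \<Phi> ` Q. dist d x < e"
    proof (intro allI impI)
      fix x :: 'x and e :: real assume e: "0 < e"
      have "\<Phi> x \<in> closure Q" using Q by blast
      then obtain q where q: "q \<in> Q" "dist q (\<Phi> x) < c * e"
        using e c unfolding closure_approachable by (metis mult_pos_pos)
      have "\<Phi> (inv \<Phi> q) = q" using q(1) Q(2) by (auto intro: f_inv_into_f)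
      then have "c * dist (inv \<Phi> q) x < c * e"
        using lip[of "inv \<Phi> q" x] q(2) by simp
      then show "\<exists>d\<in>inv \<Phi> ` Q. dist d x < e" using c q(1) by auto
    qed
  qed
qed

section \<open>Measurability in point and parameter jointly\<close>

text \<open>An open set is a countable union of rectangles: balls around points of \<open>D\<close>
  times basic open sets. The dense set is explicit because separability of \<open>'x\<close> is a
  consequence of transversality and not a type class.\<close>

lemma open_in_sets_pair_borel:
  fixes U :: "('x::metric_space \<times> 'b::{metric_space, second_countable_topology}) set"
  assumes D: "countable D" "\<forall>x::'x. \<forall>e>0. \<exists>d\<in>D. dist d x < e" and U: "open U"
  shows "U \<in> sets (borel \<Otimes>\<^sub>M borel)"
proof -
  obtain B :: "'b set set" where B: "countable B" "topological_basis B"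
    using ex_countable_basis by blast
  define I where "I = {(d, k :: nat, b). d \<in> D \<and> b \<in> B \<and> ball d (1 / real (Suc k)) \<times> b \<subseteq> U}"
  have "I \<subseteq> D \<times> UNIV \<times> B" by (auto simp: I_def)
  then have "countable I" using D B by (meson countable_SIGMA countable_subset countableI_type)
  have "U = (\<Union>(d, k, b)\<in>I. ball d (1 / real (Suc k)) \<times> b)"
  proof (intro equalityI subsetI)
    fix p assume "p \<in> U"
    then obtain A A' where A: "open A" "open A'" "p \<in> A \<times> A'" "A \<times> A' \<subseteq> U"
      using open_prod_elim[OF U] by metis
    have "snd p \<in> A'" using A(3) by auto
    then obtain b where b: "b \<in> B" "snd p \<in> b" "b \<subseteq> A'"
      using topological_basisE[OF B(2) A(2)] by metis
    obtain e where e: "0 < e" "ball (fst p) e \<subseteq> A"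
      using A(1,3) open_contains_ball[of A] by auto
    obtain k where k: "1 / real (Suc k) < e / 2"
      using nat_approx_posE[of "e / 2"] e(1) by auto
    obtain d where d: "d \<in> D" "dist d (fst p) < 1 / real (Suc k)"
      using D(2)[rule_format, of "1 / real (Suc k)" "fst p"] by auto
    have "ball d (1 / real (Suc k)) \<subseteq> ball (fst p) e"
    proof
      fix z assume "z \<in> ball d (1 / real (Suc k))"
      then show "z \<in> ball (fst p) e"
        using d(2) k dist_triangle[of "fst p" z d] by (simp add: dist_commute)
    qed
    then have "ball d (1 / real (Suc k)) \<times> b \<subseteq> A \<times> A'" using b(3) e(2) by blast
    then have "(d, k, b) \<in> I" using d(1) b(1) A(4) unfolding I_def by blast
    moreover have "p \<in> ball d (1 / real (Suc k)) \<times> b" using d b by (cases p) auto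
    ultimately show "p \<in> (\<Union>(d, k, b)\<in>I. ball d (1 / real (Suc k)) \<times> b)" by blast
  qed (auto simp: I_def)
  moreover have "(\<Union>(d, k, b)\<in>I. ball d (1 / real (Suc k)) \<times> b) \<in> sets (borel \<Otimes>\<^sub>M borel)"
    using \<open>countable I\<close>
  proof (rule sets.countable_UN')
    show "(\<lambda>(d, k, b). ball d (1 / real (Suc k)) \<times> b) ` I \<subseteq> sets (borel \<Otimes>\<^sub>M borel)"
      using topological_basis_open[OF B(2)] by (auto simp: I_def)
  qed
  ultimately show ?thesis by simp
qed

text \<open>The extension by 0 is usually discontinuous, but it only adds the rectangle
  \<open>UNIV \<times> (- \<Lambda>)\<close> to preimages of open sets containing 0.\<close>

lemma measurable_continuous_on_pair_borel:
  fixes f :: "'x::metric_space \<times> 'b::{metric_space, second_countable_topology} \<Rightarrow> 'c::{topological_space, zero}"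
  assumes D: "countable D" "\<forall>x::'x. \<forall>e>0. \<exists>d\<in>D. dist d x < e"
    and \<Lambda>: "open \<Lambda>" and f: "continuous_on (UNIV \<times> \<Lambda>) f"
  shows "(\<lambda>p. if snd p \<in> \<Lambda> then f p else 0) \<in> borel_measurable (borel \<Otimes>\<^sub>M borel)"
proof (rule borel_measurableI)
  fix S :: "'c set" assume S: "open S"
  have "open ((UNIV \<times> \<Lambda>) \<inter> f -` S)"
    using continuous_open_preimage[OF f _ S] \<Lambda> open_Times by blast
  then have 1: "(UNIV \<times> \<Lambda>) \<inter> f -` S \<in> sets (borel \<Otimes>\<^sub>M borel)"
    by (rule open_in_sets_pair_borel[OF D])
  have 2: "(if 0 \<in> S then UNIV \<times> (- \<Lambda>) else {}) \<in> sets (borel \<Otimes>\<^sub>M borel)"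
    using \<Lambda> by (auto intro!: pair_measureI)
  have "(\<lambda>p. if snd p \<in> \<Lambda> then f p else 0) -` S \<inter> space (borel \<Otimes>\<^sub>M borel)
      = ((UNIV \<times> \<Lambda>) \<inter> f -` S) \<union> (if 0 \<in> S then UNIV \<times> (- \<Lambda>) else {})"
    by (auto simp: space_pair_measure split: if_splits)
  also have "\<dots> \<in> sets (borel \<Otimes>\<^sub>M borel)" using 1 2 by (rule sets.Un)
  finally show "(\<lambda>p. if snd p \<in> \<Lambda> then f p else 0) -` S \<inter> space (borel \<Otimes>\<^sub>M borel)
      \<in> sets (borel \<Otimes>\<^sub>M borel)" .
qed

section \<open>Singular images\<close>

lemma lower_dens_distr:
  fixes f :: "'x \<Rightarrow> 'a::euclidean_space"
  assumes f: "f \<in> borel_measurable \<kappa>" and sp: "space \<kappa> = UNIV"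
  shows "lower_dens (distr \<kappa> borel f) y =
    liminf (\<lambda>n. ennreal ((2 ^ n) ^ DIM('a)) * emeasure \<kappa> {x. dist y (f x) \<le> (1 / 2) ^ n})"
proof -
  have "emeasure (distr \<kappa> borel f) (cball y r) = emeasure \<kappa> {x. dist y (f x) \<le> r}" for r
    using f sp by (subst emeasure_distr) (auto simp: vimage_def)
  then show ?thesis by (simp add: lower_dens_def)
qed

lemma measurable_emeasure_dist_le:
  fixes q :: "'x::topological_space \<Rightarrow> 'b::topological_space \<Rightarrow> 'a::euclidean_space"
  assumes q: "(\<lambda>p. q (fst p) (snd p)) \<in> borel_measurable (borel \<Otimes>\<^sub>M borel)"
    and \<kappa>: "finite_measure \<kappa>" "sets \<kappa> = sets borel"
  shows "(\<lambda>p. emeasure \<kappa> {x'. dist (q (fst p) (snd p)) (q x' (snd p)) \<le> r})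
    \<in> borel_measurable (borel \<Otimes>\<^sub>M borel)"
proof -
  interpret finite_measure \<kappa> by fact
  let ?M = "(borel \<Otimes>\<^sub>M borel) \<Otimes>\<^sub>M borel :: (('x \<times> 'b) \<times> 'x) measure"
  have [measurable]: "(\<lambda>p. q (fst (fst p)) (snd (fst p))) \<in> borel_measurable ?M"
    by (rule measurable_compose[OF measurable_fst q])
  have "(\<lambda>p. (snd p, snd (fst p))) \<in> measurable ?M (borel \<Otimes>\<^sub>M borel)" by measurable
  from measurable_compose[OF this q]
  have [measurable]: "(\<lambda>p. q (snd p) (snd (fst p))) \<in> borel_measurable ?M" by simp
  have "{p \<in> space ?M. dist (q (fst (fst p)) (snd (fst p))) (q (snd p) (snd (fst p))) \<le> r} \<in> sets ?M"
    by measurable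
  then have "{p. dist (q (fst (fst p)) (snd (fst p))) (q (snd p) (snd (fst p))) \<le> r} \<in> sets ?M"
    by (simp add: space_pair_measure)
  then have "{p. dist (q (fst (fst p)) (snd (fst p))) (q (snd p) (snd (fst p))) \<le> r}
      \<in> sets ((borel \<Otimes>\<^sub>M borel) \<Otimes>\<^sub>M \<kappa>)"
    using sets_pair_measure_cong[OF refl \<kappa>(2)] by blast
  from measurable_emeasure_Pair[OF this] show ?thesis
    by (simp add: vimage_def)
qed

lemma measurable_section:
  assumes q: "(\<lambda>p. q (fst p) (snd p)) \<in> borel_measurable (borel \<Otimes>\<^sub>M borel)"
  shows "(\<lambda>x. q x u) \<in> borel_measurable borel"
  using measurable_compose[OF measurable_Pair2'[of u borel borel] q] by simp

lemma measurable_lower_dens_distr: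
  fixes q :: "'x::topological_space \<Rightarrow> 'b::topological_space \<Rightarrow> 'a::euclidean_space"
  assumes q: "(\<lambda>p. q (fst p) (snd p)) \<in> borel_measurable (borel \<Otimes>\<^sub>M borel)"
    and \<kappa>: "finite_measure \<kappa>" "sets \<kappa> = sets borel"
  shows "(\<lambda>p. lower_dens (distr \<kappa> borel (\<lambda>x'. q x' (snd p))) (q (fst p) (snd p)))
    \<in> borel_measurable (borel \<Otimes>\<^sub>M borel)"
proof -
  have "(\<lambda>x'. q x' u) \<in> borel_measurable \<kappa>" for u
    using measurable_section[OF q] measurable_cong_sets[OF \<kappa>(2) refl] by blast
  moreover have "space \<kappa> = UNIV" using sets_eq_imp_space_eq[OF \<kappa>(2)] by simp
  ultimately show ?thesis
    using measurable_emeasure_dist_le[OF q \<kappa>] by (simp add: lower_dens_distr)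
qed

text \<open>Fatou's lemma: the sublevel estimate in the parameter, averaged over the base point,
  bounds the lower densities of the image measures.\<close>

lemma AE_lower_dens_finite:
  fixes q :: "'x::topological_space \<Rightarrow> 'b::euclidean_space \<Rightarrow> 'a::euclidean_space"
  assumes q: "(\<lambda>p. q (fst p) (snd p)) \<in> borel_measurable (borel \<Otimes>\<^sub>M borel)"
    and \<kappa>: "finite_measure \<kappa>" "sets \<kappa> = sets borel"
    and b: "b \<in> sets borel" and \<rho>0: "0 < \<rho>0"
    and M: "AE x' in \<kappa>. \<forall>\<rho>. 0 < \<rho> \<and> \<rho> \<le> \<rho>0 \<longrightarrow>
      emeasure lborel {u\<in>b. dist (q x u) (q x' u) \<le> \<rho>} \<le> ennreal (M * \<rho> ^ DIM('a))"
  shows "AE u in lborel. u \<in> b \<longrightarrow> lower_dens (distr \<kappa> borel (\<lambda>x'. q x' u)) (q x u) < top"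
proof -
  interpret \<kappa>: finite_measure \<kappa> by fact
  interpret pair_sigma_finite \<kappa> "lborel :: 'b measure" ..
  have sp: "space \<kappa> = UNIV" using sets_eq_imp_space_eq[OF \<kappa>(2)] by simp
  have qk: "(\<lambda>x'. q x' u) \<in> borel_measurable \<kappa>" for u
    using measurable_section[OF q] measurable_cong_sets[OF \<kappa>(2) refl] by blast
  define c :: "nat \<Rightarrow> ennreal" where "c n = ennreal ((2 ^ n) ^ DIM('a))" for n
  define a where "a n u = c n * (emeasure \<kappa> {x'. dist (q x u) (q x' u) \<le> (1 / 2) ^ n} * indicator b u)" for n u
  have "(\<lambda>u. (x, u)) \<in> measurable borel (borel \<Otimes>\<^sub>M borel)" by measurable
  from measurable_compose[OF this measurable_emeasure_dist_le[OF q \<kappa>]]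
  have "(\<lambda>u. emeasure \<kappa> {x'. dist (q x u) (q x' u) \<le> r}) \<in> borel_measurable borel" for r by simp
  then have am: "a n \<in> borel_measurable lborel" for n
    unfolding a_def[abs_def] using b by measurable
  have int: "(\<integral>\<^sup>+u. a n u \<partial>lborel) \<le> ennreal M * emeasure \<kappa> UNIV" if n: "(1 / 2) ^ n \<le> \<rho>0" for n
  proof -
    define r :: real where "r = (1 / 2) ^ n"
    have r: "0 < r" "r \<le> \<rho>0" using n by (auto simp: r_def)
    \<comment> \<open>Its sections at fixed \<open>u\<close> have the ball masses as
      \<open>\<kappa>\<close>-measure; its sections at fixed \<open>x'\<close> are the sublevel sets
      of the hypothesis. Tonelli's theorem exchanges the two.\<close>
    define W where "W = {p. snd p \<in> b \<and> dist (q x (snd p)) (q (fst p) (snd p)) \<le> r}"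
    let ?M = "borel \<Otimes>\<^sub>M borel :: ('x \<times> 'b) measure"
    have "(\<lambda>p. (x, snd p)) \<in> measurable ?M (borel \<Otimes>\<^sub>M borel)" by measurable
    from measurable_compose[OF this q]
    have [measurable]: "(\<lambda>p. q x (snd p)) \<in> borel_measurable ?M" by simp
    note [measurable] = q b
    have "{p \<in> space ?M. snd p \<in> b \<and> dist (q x (snd p)) (q (fst p) (snd p)) \<le> r} \<in> sets ?M"
      by measurable
    then have "W \<in> sets ?M" by (simp add: W_def space_pair_measure)
    moreover have "sets ?M = sets (\<kappa> \<Otimes>\<^sub>M lborel)"
      by (rule sets_pair_measure_cong) (simp_all add: \<kappa>)
    ultimately have W: "W \<in> sets (\<kappa> \<Otimes>\<^sub>M lborel)" by simp
    have "emeasure \<kappa> ((\<lambda>x'. (x', u)) -` W)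
        = emeasure \<kappa> {x'. dist (q x u) (q x' u) \<le> r} * indicator b u" for u
      by (auto simp: W_def vimage_def indicator_def)
    then have "(\<integral>\<^sup>+u. emeasure \<kappa> {x'. dist (q x u) (q x' u) \<le> r} * indicator b u \<partial>lborel)
        = emeasure (\<kappa> \<Otimes>\<^sub>M lborel) W"
      using emeasure_pair_measure_alt2[OF W] by simp
    also have "\<dots> = (\<integral>\<^sup>+x'. emeasure lborel (Pair x' -` W) \<partial>\<kappa>)"
      by (rule lborel.emeasure_pair_measure_alt[OF W])
    also have "\<dots> \<le> (\<integral>\<^sup>+x'. ennreal (M * r ^ DIM('a)) \<partial>\<kappa>)"
    proof (rule nn_integral_mono_AE)
      show "AE x' in \<kappa>. emeasure lborel (Pair x' -` W) \<le> ennreal (M * r ^ DIM('a))"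
        using M r by (auto simp: W_def vimage_def)
    qed
    also have "\<dots> = ennreal (M * r ^ DIM('a)) * emeasure \<kappa> UNIV" by (simp add: sp)
    finally have le: "(\<integral>\<^sup>+u. emeasure \<kappa> {x'. dist (q x u) (q x' u) \<le> r} * indicator b u \<partial>lborel)
        \<le> ennreal (M * r ^ DIM('a)) * emeasure \<kappa> UNIV" .
    have "(\<lambda>u. (x, u)) \<in> measurable borel (borel \<Otimes>\<^sub>M borel)" by measurable
    from measurable_compose[OF this measurable_emeasure_dist_le[OF q \<kappa>]]
    have "(\<lambda>u. emeasure \<kappa> {x'. dist (q x u) (q x' u) \<le> r} * indicator b u) \<in> borel_measurable lborel"
      using b by simp
    then have "(\<integral>\<^sup>+u. a n u \<partial>lborel)
        = c n * (\<integral>\<^sup>+u. emeasure \<kappa> {x'. dist (q x u) (q x' u) \<le> r} * indicator b u \<partial>lborel)"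
      unfolding a_def r_def[symmetric] by (rule nn_integral_cmult)
    also have "\<dots> \<le> c n * (ennreal (M * r ^ DIM('a)) * emeasure \<kappa> UNIV)"
      by (intro mult_left_mono le) simp
    \<comment> \<open>The density scaling cancels \<open>r ^ DIM('a)\<close> exactly, so the bound
      is independent of \<open>n\<close>.\<close>
    also have "c n * (ennreal (M * r ^ DIM('a)) * emeasure \<kappa> UNIV) = ennreal M * emeasure \<kappa> UNIV"
    proof -
      have "c n * ennreal (M * r ^ DIM('a)) = ennreal ((2 ^ n) ^ DIM('a) * (M * r ^ DIM('a)))"
        unfolding c_def by (rule ennreal_mult'[symmetric]) simp
      also have "(2 ^ n) ^ DIM('a) * (M * r ^ DIM('a)) = M * ((2 ^ n * r) ^ DIM('a))"
        by (simp add: power_mult_distrib)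
      also have "2 ^ n * r = 1" by (simp add: r_def power_mult_distrib[symmetric])
      finally show ?thesis by (simp add: mult.assoc[symmetric])
    qed
    finally show ?thesis .
  qed
  have "eventually (\<lambda>n. (1 / 2 :: real) ^ n < \<rho>0) sequentially"
    using \<rho>0 by (intro order_tendstoD(2)[OF LIMSEQ_realpow_zero]) auto
  then have "eventually (\<lambda>n. (\<integral>\<^sup>+u. a n u \<partial>lborel) \<le> ennreal M * emeasure \<kappa> UNIV) sequentially"
    by eventually_elim (intro int, simp)
  then have "limsup (\<lambda>n. \<integral>\<^sup>+u. a n u \<partial>lborel) \<le> ennreal M * emeasure \<kappa> UNIV"
    by (rule Limsup_bounded)
  then have "liminf (\<lambda>n. \<integral>\<^sup>+u. a n u \<partial>lborel) \<le> ennreal M * emeasure \<kappa> UNIV"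
    using Liminf_le_Limsup[of sequentially "\<lambda>n. \<integral>\<^sup>+u. a n u \<partial>lborel"] by (meson order_trans sequentially_bot)
  moreover have "(\<integral>\<^sup>+u. liminf (\<lambda>n. a n u) \<partial>lborel) \<le> liminf (\<lambda>n. \<integral>\<^sup>+u. a n u \<partial>lborel)"
    by (rule nn_integral_liminf[OF am])
  ultimately have "(\<integral>\<^sup>+u. liminf (\<lambda>n. a n u) \<partial>lborel) \<le> ennreal M * emeasure \<kappa> UNIV"
    by (meson order_trans)
  also have "\<dots> < \<infinity>"
    using \<kappa>.emeasure_finite[of UNIV] by (simp add: ennreal_mult_eq_top_iff less_top[symmetric])
  finally have fin: "(\<integral>\<^sup>+u. liminf (\<lambda>n. a n u) \<partial>lborel) \<noteq> \<infinity>" by simp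
  have "(\<lambda>u. liminf (\<lambda>n. a n u)) \<in> borel_measurable lborel"
    using am by measurable
  from nn_integral_noteq_infinite[OF this fin]
  have "AE u in lborel. liminf (\<lambda>n. a n u) \<noteq> \<infinity>" .
  then show ?thesis
  proof eventually_elim
    case (elim u)
    show ?case
    proof
      assume "u \<in> b"
      then have "a n u = ennreal ((2 ^ n) ^ DIM('a)) * emeasure \<kappa> {x'. dist (q x u) (q x' u) \<le> (1 / 2) ^ n}" for n
        by (simp add: a_def c_def)
      then show "lower_dens (distr \<kappa> borel (\<lambda>x'. q x' u)) (q x u) < top"
        using elim by (simp add: lower_dens_distr[OF qk sp] less_top)
    qed
  qed
qed

text \<open>By \<open>sing\<close>, \<open>\<nu>\<close> is carried by the Lebesgue null set where
  its own lower density is infinite, and so is \<open>\<nu>'\<close>, which is dominated by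
  \<open>\<nu>\<close>. On a null set \<open>\<nu>'\<close> does not charge the points where its own
  lower density is finite.\<close>

lemma AE_lower_dens_restrict_infinite:
  fixes f :: "'x::topological_space \<Rightarrow> 'a::euclidean_space"
  assumes \<mu>: "finite_measure \<mu>" "sets \<mu> = sets borel" and f: "f \<in> borel_measurable borel"
    and C: "C \<in> sets borel"
    and sing: "emeasure (distr \<mu> borel f) {y. lower_dens (distr \<mu> borel f) y < top} = 0"
  shows "AE x in \<mu>. x \<in> C \<longrightarrow> lower_dens (distr (density \<mu> (indicator C)) borel f) (f x) = top"
proof -
  interpret \<mu>: finite_measure \<mu> by fact
  have sp: "space \<mu> = UNIV" using sets_eq_imp_space_eq[OF \<mu>(2)] by simp
  have [measurable]: "f \<in> borel_measurable \<mu>" "C \<in> sets \<mu>"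
    using f C measurable_cong_sets[OF \<mu>(2) refl] \<mu>(2) by auto
  define \<kappa> where "\<kappa> = density \<mu> (indicator C)"
  define \<nu> where "\<nu> = distr \<mu> borel f"
  define \<nu>' where "\<nu>' = distr \<kappa> borel f"
  have \<kappa>e: "emeasure \<kappa> A = emeasure \<mu> (C \<inter> A)" if "A \<in> sets \<mu>" for A
    using that C \<mu>(2) unfolding \<kappa>_def
    by (subst emeasure_density) (auto simp flip: indicator_inter_arith)
  have [measurable]: "f \<in> borel_measurable \<kappa>" by (simp add: \<kappa>_def)
  have spk: "space \<kappa> = UNIV" by (simp add: \<kappa>_def sp)
  have "finite_measure \<kappa>"
    by (rule finite_measureI) (simp add: spk \<kappa>e sp[symmetric])
  then have fin': "finite_measure \<nu>'"
    unfolding \<nu>'_def by (rule finite_measure.finite_measure_distr) measurable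
  have fin: "finite_measure \<nu>"
    unfolding \<nu>_def by (rule \<mu>.finite_measure_distr) measurable
  have s: "sets \<nu>' = sets borel" "sets \<nu> = sets borel" by (simp_all add: \<nu>'_def \<nu>_def)
  note [measurable] = borel_measurable_lower_dens[OF fin' s(1)] borel_measurable_lower_dens[OF fin s(2)]
  have pre: "f -` A \<in> sets \<mu>" if "A \<in> sets borel" for A
    using measurable_sets[OF \<open>f \<in> borel_measurable \<mu>\<close> that] sp by simp
  have \<nu>'e: "emeasure \<nu>' A = emeasure \<mu> (C \<inter> f -` A)" if "A \<in> sets borel" for A
    unfolding \<nu>'_def using that pre[OF that] by (simp add: emeasure_distr spk \<kappa>e)
  have \<nu>e: "emeasure \<nu> A = emeasure \<mu> (f -` A)" if "A \<in> sets borel" for A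
    unfolding \<nu>_def using that by (simp add: emeasure_distr sp)
  let ?F' = "{y. lower_dens \<nu>' y < top}"
  let ?F = "{y. lower_dens \<nu> y < top}"
  let ?N = "{y. lower_dens \<nu> y = top}"
  have N: "?N \<in> null_sets lborel" by (rule infinite_lower_dens_null_set[OF fin s(2)])
  have F'b: "?F' \<in> sets borel" and Fb: "?F \<in> sets borel" by measurable
  have "emeasure \<nu>' ?F \<le> emeasure \<nu> ?F"
    unfolding \<nu>'e[OF Fb] \<nu>e[OF Fb] by (rule emeasure_mono) (use pre[OF Fb] in auto)
  then have "emeasure \<nu>' ?F = 0" using sing by (simp add: \<nu>_def)
  moreover have "emeasure \<nu>' {y\<in>?N. lower_dens \<nu>' y < top} = 0"
    by (rule emeasure_finite_lower_dens_null[OF fin' s(1) N])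
  moreover have "emeasure \<nu>' ?F' \<le> emeasure \<nu>' (?F \<union> {y\<in>?N. lower_dens \<nu>' y < top})"
    by (rule emeasure_mono) (auto simp: s not_less top_unique)
  moreover have "emeasure \<nu>' (?F \<union> {y\<in>?N. lower_dens \<nu>' y < top})
      \<le> emeasure \<nu>' ?F + emeasure \<nu>' {y\<in>?N. lower_dens \<nu>' y < top}"
    by (rule emeasure_subadditive) (simp_all add: s)
  ultimately have "emeasure \<nu>' ?F' = 0" by simp
  then have "emeasure \<mu> (C \<inter> f -` ?F') = 0" by (simp add: \<nu>'e[OF F'b])
  then have "C \<inter> f -` ?F' \<in> null_sets \<mu>"
    using pre[OF F'b] C \<mu>(2) by (auto simp: null_sets_def)
  then have "AE x in \<mu>. x \<notin> C \<inter> f -` ?F'" by (rule AE_not_in)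
  then show ?thesis
    by eventually_elim (auto simp: \<nu>'_def \<kappa>_def not_less top_unique)
qed


text \<open>If \<open>f x = f x'\<close> for distinct points off the null set, a pair separating
  them puts the common value both inside and outside \<open>G i\<close>. Countability of
  \<open>I\<close> merges the exceptional sets.\<close>

lemma AE_inj_on_full_set:
  fixes f :: "'x \<Rightarrow> 'a"
  assumes I: "countable I"
    and sep: "\<And>x x'. x \<noteq> x' \<Longrightarrow> \<exists>i\<in>I. x \<in> A i \<and> x' \<in> C i"
    and A: "\<And>i. i \<in> I \<Longrightarrow> AE x in \<mu>. x \<in> A i \<longrightarrow> f x \<in> G i"
    and C: "\<And>i. i \<in> I \<Longrightarrow> AE x in \<mu>. x \<in> C i \<longrightarrow> f x \<notin> G i"
  shows "\<exists>B\<in>sets \<mu>. emeasure \<mu> (space \<mu> - B) = 0 \<and> inj_on f B"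
proof -
  have "AE x in \<mu>. \<forall>i\<in>I. (x \<in> A i \<longrightarrow> f x \<in> G i) \<and> (x \<in> C i \<longrightarrow> f x \<notin> G i)"
    unfolding AE_ball_countable[OF I] using A C by auto
  then obtain N where N: "N \<in> null_sets \<mu>"
    "{x\<in>space \<mu>. \<not> (\<forall>i\<in>I. (x \<in> A i \<longrightarrow> f x \<in> G i) \<and> (x \<in> C i \<longrightarrow> f x \<notin> G i))} \<subseteq> N"
    by (auto simp: eventually_ae_filter)
  have "inj_on f (space \<mu> - N)"
  proof (rule inj_onI, rule ccontr)
    fix x x' assume x: "x \<in> space \<mu> - N" "x' \<in> space \<mu> - N" "f x = f x'" "x \<noteq> x'"
    then obtain i where "i \<in> I" "x \<in> A i" "x' \<in> C i" using sep by blast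
    moreover have "f x \<in> G i" "f x' \<notin> G i" using N(2) x calculation by blast+
    ultimately show False using x(3) by simp
  qed
  moreover have "space \<mu> - (space \<mu> - N) = N" using N(1) sets.sets_into_space[of N \<mu>] by auto
  ultimately show ?thesis using N(1) by (intro bexI[of _ "space \<mu> - N"]) auto
qed

text \<open>For radius \<open>r\<close>, centres at least \<open>3 * r\<close> apart leave distance
  \<open>r\<close> between the balls; centres within \<open>r\<close> of two points more than
  \<open>5 * r\<close> apart are that far apart.\<close>

lemma countable_separating_balls:
  fixes D :: "'x::metric_space set"
  assumes D: "countable D" "\<forall>x. \<forall>e>0. \<exists>d\<in>D. dist d x < e"
  obtains I :: "('x \<times> 'x \<times> nat) set" where "countable I"
    "\<And>x x'. x \<noteq> x' \<Longrightarrow> \<exists>(d, d', k)\<in>I. x \<in> ball d (1 / real (Suc k)) \<and> x' \<in> ball d' (1 / real (Suc k))"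
    "\<And>d d' k x x'. (d, d', k) \<in> I \<Longrightarrow> x \<in> ball d (1 / real (Suc k)) \<Longrightarrow>
      x' \<in> ball d' (1 / real (Suc k)) \<Longrightarrow> 1 / real (Suc k) \<le> dist x x'"
proof
  define I where "I = {(d, d', k). d \<in> D \<and> d' \<in> D \<and> 3 / real (Suc k) \<le> dist d d'}"
  have "I \<subseteq> D \<times> D \<times> UNIV" by (auto simp: I_def)
  then show "countable I" using D(1) by (meson countable_SIGMA countable_subset countableI_type)
  show "\<exists>(d, d', k)\<in>I. x \<in> ball d (1 / real (Suc k)) \<and> x' \<in> ball d' (1 / real (Suc k))"
    if "x \<noteq> x'" for x x'
  proof -
    obtain k where k: "1 / real (Suc k) < dist x x' / 5"
      using nat_approx_posE[of "dist x x' / 5"] \<open>x \<noteq> x'\<close> by auto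
    have pos: "0 < 1 / real (Suc k)" by simp
    obtain d where d: "d \<in> D" "dist d x < 1 / real (Suc k)" using D(2) pos by blast
    obtain d' where d': "d' \<in> D" "dist d' x' < 1 / real (Suc k)" using D(2) pos by blast
    have "dist x x' \<le> dist d x + dist d d' + dist d' x'"
      using dist_triangle[of x x' d] dist_triangle[of d x' d'] by (simp add: dist_commute)
    then have "3 * (1 / real (Suc k)) \<le> dist d d'" using d d' k by linarith
    then have "(d, d', k) \<in> I" using d d' by (simp add: I_def)
    with d d' show ?thesis by force
  qed
  show "1 / real (Suc k) \<le> dist x x'"
    if "(d, d', k) \<in> I" "x \<in> ball d (1 / real (Suc k))" "x' \<in> ball d' (1 / real (Suc k))" for d d' k x x'
  proof -
    have "3 * (1 / real (Suc k)) \<le> dist d d'" using that(1) by (simp add: I_def)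
    moreover have "dist d d' \<le> dist d x + dist x x' + dist d' x'"
      using dist_triangle[of d d' x] dist_triangle[of x d' x'] by (simp add: dist_commute)
    moreover have "dist d x < 1 / real (Suc k)" "dist d' x' < 1 / real (Suc k)" using that(2,3) by auto
    ultimately show ?thesis by linarith
  qed
qed

text \<open>The volume estimate holds on balls of radius at most \<open>s0\<close>; countably many
  of them cover \<open>\<Lambda>\<close> by Lindelof's theorem. Distance at least
  \<open>\<delta>\<close> turns images within \<open>\<rho>\<close> into a difference quotient of
  size at most \<open>\<rho> / \<delta>\<close>.\<close>

lemma transversal_AE_lower_dens_finite:
  fixes P :: "'x::metric_space \<Rightarrow> real ^ 'l \<Rightarrow> real ^ 'm"
  assumes tr: "transversal_family \<Lambda> P"
    and q: "(\<lambda>p. q (fst p) (snd p)) \<in> borel_measurable (borel \<Otimes>\<^sub>M borel)"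
    and qP: "\<And>x u. u \<in> \<Lambda> \<Longrightarrow> q x u = P x u"
    and \<kappa>: "finite_measure \<kappa>" "sets \<kappa> = sets borel"
    and \<delta>: "0 < \<delta>" "AE x' in \<kappa>. \<delta> \<le> dist x x'"
  shows "AE u in lborel. u \<in> \<Lambda> \<longrightarrow> lower_dens (distr \<kappa> borel (\<lambda>x'. q x' u)) (q x u) < top"
proof -
  obtain C' K where C': "0 < C'" and K: "0 < K"
    and J: "\<And>u x x'. u \<in> \<Lambda> \<Longrightarrow> x \<noteq> x' \<Longrightarrow> norm (diff_quot P x x' u) \<le> C' \<Longrightarrow>
      C' \<le> \<bar>jacobian_det (diff_quot P x x') u\<bar>"
    and K1: "\<And>u x x'. u \<in> \<Lambda> \<Longrightarrow> x \<noteq> x' \<Longrightarrow> norm (Deriv (diff_quot P x x') u) \<le> K"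
    and K2: "\<And>u x x'. u \<in> \<Lambda> \<Longrightarrow> x \<noteq> x' \<Longrightarrow> norm (Deriv (Deriv (diff_quot P x x')) u) \<le> K"
    using transversal_family_bounds[OF tr] by blast
  have \<Lambda>: "open \<Lambda>" and C2: "\<And>x. C2_on \<Lambda> (P x)" using tr by (auto simp: transversal_family_def)
  have diff: "P x differentiable (at u)" if "u \<in> \<Lambda>" for x u
    using C2[of x] that by (simp add: C2_on_def)
  have diffT: "diff_quot P x x' differentiable (at u)" if "u \<in> \<Lambda>" for x x' u
    using has_derivative_diff_quot[of P x u x'] diff[OF that] by (auto simp: differentiable_def)
  obtain s0 M where s0: "0 < s0" and vol: "\<And>(T :: real ^ 'l \<Rightarrow> real ^ 'm) a s \<rho>.
      transversal_on (cball a s) C' K T \<Longrightarrow>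
      0 < s \<Longrightarrow> s \<le> s0 \<Longrightarrow> 0 < \<rho> \<Longrightarrow> \<rho> \<le> C' \<Longrightarrow>
      emeasure lborel {u \<in> cball a s. norm (T u) \<le> \<rho>} \<le> ennreal (M * \<rho> ^ CARD('m))"
    by (rule transversal_sublevel_volume[where 'l='l and 'm='m, OF C' K], rule that)
  \<comment> \<open>The absolute value is taken because no sign of \<open>M\<close> is
    recorded.\<close>
  define M' where "M' = \<bar>M\<bar> / \<delta> ^ CARD('m)"
  have loc: "AE u in lborel. u \<in> cball a s \<longrightarrow> lower_dens (distr \<kappa> borel (\<lambda>x'. q x' u)) (q x u) < top"
    if s: "0 < s" "s \<le> s0" and sub: "cball a s \<subseteq> \<Lambda>" for a s
  proof (rule AE_lower_dens_finite[OF q \<kappa>])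
    show "cball a s \<in> sets borel" by simp
    show "0 < C' * \<delta>" using C' \<delta>(1) by simp
    show "AE x' in \<kappa>. \<forall>\<rho>. 0 < \<rho> \<and> \<rho> \<le> C' * \<delta> \<longrightarrow>
        emeasure lborel {u \<in> cball a s. dist (q x u) (q x' u) \<le> \<rho>} \<le> ennreal (M' * \<rho> ^ DIM(real ^ 'm))"
      using \<delta>(2)
    proof eventually_elim
      case (elim x')
      then have ne: "x \<noteq> x'" using \<delta>(1) by auto
      show ?case
      proof (intro allI impI)
        fix \<rho> :: real assume \<rho>: "0 < \<rho> \<and> \<rho> \<le> C' * \<delta>"
        have sub': "{u \<in> cball a s. dist (q x u) (q x' u) \<le> \<rho>}
            \<subseteq> {u \<in> cball a s. norm (diff_quot P x x' u) \<le> \<rho> / \<delta>}"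
        proof safe
          fix u assume u: "u \<in> cball a s" "dist (q x u) (q x' u) \<le> \<rho>"
          have "norm (diff_quot P x x' u) = dist (q x u) (q x' u) / dist x x'"
            using u(1) sub by (simp add: diff_quot_def qP subset_iff dist_norm divide_inverse_commute)
          also have "\<dots> \<le> \<rho> / \<delta>"
            using u(2) elim \<delta>(1) \<rho> by (intro frac_le) auto
          finally show "norm (diff_quot P x x' u) \<le> \<rho> / \<delta>" .
        qed
        have "closed ((cball a s) \<inter> diff_quot P x x' -` cball 0 (\<rho> / \<delta>))"
          using diffT sub
          by (intro continuous_closed_preimage closed_cball continuous_at_imp_continuous_on ballI
              differentiable_imp_continuous_within) auto
        moreover have "(cball a s) \<inter> diff_quot P x x' -` cball 0 (\<rho> / \<delta>)
            = {u \<in> cball a s. norm (diff_quot P x x' u) \<le> \<rho> / \<delta>}" by auto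
        ultimately have "closed {u \<in> cball a s. norm (diff_quot P x x' u) \<le> \<rho> / \<delta>}" by simp
        then have "emeasure lborel {u \<in> cball a s. dist (q x u) (q x' u) \<le> \<rho>}
            \<le> emeasure lborel {u \<in> cball a s. norm (diff_quot P x x' u) \<le> \<rho> / \<delta>}"
          using sub' by (intro emeasure_mono) simp_all
        also have "\<dots> \<le> ennreal (M * (\<rho> / \<delta>) ^ CARD('m))"
        proof (rule vol)
          show "transversal_on (cball a s) C' K (diff_quot P x x')"
            unfolding transversal_on_def
          proof (intro ballI conjI impI)
            fix u assume "u \<in> cball a s"
            then have u: "u \<in> \<Lambda>" using sub by blast
            show "diff_quot P x x' differentiable (at u)" by (rule diffT[OF u])
            show "Deriv (diff_quot P x x') differentiable (at u)"
              by (rule Deriv_diff_quot_differentiable[OF C2 \<Lambda> u])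
            show "norm (Deriv (diff_quot P x x') u) \<le> K" by (rule K1[OF u ne])
            show "norm (Deriv (Deriv (diff_quot P x x')) u) \<le> K" by (rule K2[OF u ne])
            show "C' \<le> \<bar>jacobian_det (diff_quot P x x') u\<bar>" if "norm (diff_quot P x x' u) \<le> C'"
              by (rule J[OF u ne that])
          qed
        qed (use s \<rho> \<delta>(1) in \<open>auto simp: field_simps\<close>)
        also have "\<dots> \<le> ennreal (M' * \<rho> ^ DIM(real ^ 'm))"
          using \<rho> \<delta>(1) by (intro ennreal_leI) (simp add: M'_def power_divide divide_right_mono mult_right_mono)
        finally show "emeasure lborel {u \<in> cball a s. dist (q x u) (q x' u) \<le> \<rho>}
            \<le> ennreal (M' * \<rho> ^ DIM(real ^ 'm))" .
      qed
    qed
  qed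
  define \<F> where "\<F> = {ball a s |a s. 0 < s \<and> s \<le> s0 \<and> cball a s \<subseteq> \<Lambda>}"
  have "\<And>S. S \<in> \<F> \<Longrightarrow> open S" by (auto simp: \<F>_def)
  then obtain \<F>' where F': "\<F>' \<subseteq> \<F>" "countable \<F>'" "\<Union>\<F>' = \<Union>\<F>"
    using Lindelof[of \<F>] by metis
  have "\<Lambda> \<subseteq> \<Union>\<F>"
  proof
    fix u assume "u \<in> \<Lambda>"
    then obtain e where e: "0 < e" "cball u e \<subseteq> \<Lambda>" using \<Lambda> open_contains_cball by blast
    then have "ball u (min e s0) \<in> \<F>" using s0 unfolding \<F>_def by force
    moreover have "u \<in> ball u (min e s0)" using e s0 by simp
    ultimately show "u \<in> \<Union>\<F>" by blast
  qed
  moreover have "AE u in lborel. \<forall>S\<in>\<F>'. u \<in> S \<longrightarrow> lower_dens (distr \<kappa> borel (\<lambda>x'. q x' u)) (q x u) < top"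
    unfolding AE_ball_countable[OF F'(2)]
  proof
    fix S assume "S \<in> \<F>'"
    then obtain a s where S: "S = ball a s" "0 < s" "s \<le> s0" "cball a s \<subseteq> \<Lambda>"
      using F'(1) unfolding \<F>_def by blast
    show "AE u in lborel. u \<in> S \<longrightarrow> lower_dens (distr \<kappa> borel (\<lambda>x'. q x' u)) (q x u) < top"
      using loc[OF S(2-4)] by eventually_elim (use S(1) ball_subset_cball in blast)
  qed
  ultimately show ?thesis
    using F'(3) by (elim eventually_mono) blast
qed

text \<open>The set \<open>G u i\<close> of finite lower density separates the two images: it
  catches the image of \<open>A i\<close> by transversality and misses that of \<open>C i\<close> by
  singularity, up to null sets.\<close>

lemma AE_transversal_inj_on:
  fixes P :: "'x::metric_space \<Rightarrow> real ^ 'l \<Rightarrow> real ^ 'm"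
  assumes tr: "transversal_family \<Lambda> P"
    and q: "(\<lambda>p. q (fst p) (snd p)) \<in> borel_measurable (borel \<Otimes>\<^sub>M borel)"
    and qP: "\<And>x u. u \<in> \<Lambda> \<Longrightarrow> q x u = P x u"
    and D: "countable D" "\<forall>x::'x. \<forall>e>0. \<exists>d\<in>D. dist d x < e"
    and \<mu>: "finite_measure \<mu>" "sets \<mu> = sets borel" and S: "S \<subseteq> \<Lambda>"
    and sing: "AE u in lborel. u \<in> S \<longrightarrow> emeasure (distr \<mu> borel (\<lambda>x. q x u))
      {y. lower_dens (distr \<mu> borel (\<lambda>x. q x u)) y < top} = 0"
  shows "AE u in lborel. u \<in> S \<longrightarrow>
    (\<exists>B\<in>sets \<mu>. emeasure \<mu> (space \<mu> - B) = 0 \<and> inj_on (\<lambda>x. P x u) B)"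
proof -
  interpret \<mu>: finite_measure \<mu> by fact
  interpret pair_sigma_finite \<mu> "lborel :: (real ^ 'l) measure" ..
  have sp: "space \<mu> = UNIV" using sets_eq_imp_space_eq[OF \<mu>(2)] by simp
  obtain I :: "('x \<times> 'x \<times> nat) set" where I: "countable I"
    "\<And>x x'. x \<noteq> x' \<Longrightarrow> \<exists>(d, d', k)\<in>I. x \<in> ball d (1 / real (Suc k)) \<and> x' \<in> ball d' (1 / real (Suc k))"
    "\<And>d d' k x x'. (d, d', k) \<in> I \<Longrightarrow> x \<in> ball d (1 / real (Suc k)) \<Longrightarrow>
      x' \<in> ball d' (1 / real (Suc k)) \<Longrightarrow> 1 / real (Suc k) \<le> dist x x'"
    by (rule countable_separating_balls[OF D], rule that)
  define A where "A = (\<lambda>(d :: 'x, d' :: 'x, k). ball d (1 / real (Suc k)))"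
  define C where "C = (\<lambda>(d :: 'x, d' :: 'x, k). ball d' (1 / real (Suc k)))"
  define \<kappa> where "\<kappa> i = density \<mu> (indicator (C i))" for i
  define G where "G u i = {y. lower_dens (distr (\<kappa> i) borel (\<lambda>x. q x u)) y < top}" for u i
  have Cb: "C i \<in> sets \<mu>" "C i \<in> sets borel" and Ab: "A i \<in> sets borel" for i
    by (auto simp: C_def A_def \<mu>(2) split: prod.split)
  have "AE u in lborel. u \<in> \<Lambda> \<longrightarrow> (AE x in \<mu>. x \<in> A i \<longrightarrow> q x u \<in> G u i)" if i: "i \<in> I" for i
  proof -
    obtain d d' k where ik: "i = (d, d', k)" by (cases i)
    have "emeasure (\<kappa> i) UNIV \<noteq> \<infinity>"
    proof -
      have "emeasure (\<kappa> i) UNIV = emeasure \<mu> (C i)"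
        unfolding \<kappa>_def using Cb sp sets.top[of \<mu>] by (subst emeasure_density) auto
      then show ?thesis by simp
    qed
    then have \<kappa>: "finite_measure (\<kappa> i)" "sets (\<kappa> i) = sets borel"
      using \<mu>(2) by (auto intro!: finite_measureI simp: \<kappa>_def sp)
    have x: "AE u in lborel. u \<in> \<Lambda> \<longrightarrow> lower_dens (distr (\<kappa> i) borel (\<lambda>x'. q x' u)) (q x u) < top"
      if x: "x \<in> A i" for x
    proof (rule transversal_AE_lower_dens_finite[OF tr q qP \<kappa>])
      show "0 < 1 / real (Suc k)" by simp
      have "AE x' in \<mu>. 0 < (indicator (C i) x' :: ennreal) \<longrightarrow> 1 / real (Suc k) \<le> dist x x'"
        using I(3)[of d d' k x] i x by (auto simp: ik A_def C_def indicator_def)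
      then show "AE x' in \<kappa> i. 1 / real (Suc k) \<le> dist x x'"
        unfolding \<kappa>_def using Cb by (subst AE_density) auto
    qed
    let ?M = "borel \<Otimes>\<^sub>M borel :: ('x \<times> (real ^ 'l)) measure"
    note [measurable] = measurable_lower_dens_distr[OF q \<kappa>] Ab[of i]
    have [measurable]: "\<Lambda> \<in> sets borel" using tr by (simp add: transversal_family_def)
    have "{p \<in> space ?M. fst p \<in> A i \<longrightarrow> snd p \<in> \<Lambda> \<longrightarrow>
        lower_dens (distr (\<kappa> i) borel (\<lambda>x'. q x' (snd p))) (q (fst p) (snd p)) < top} \<in> sets ?M"
      by measurable
    moreover have eqM: "sets ?M = sets (\<mu> \<Otimes>\<^sub>M lborel)"
      by (rule sets_pair_measure_cong) (simp_all add: \<mu>)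
    ultimately have "{p \<in> space (\<mu> \<Otimes>\<^sub>M lborel). fst p \<in> A i \<longrightarrow> snd p \<in> \<Lambda> \<longrightarrow>
        lower_dens (distr (\<kappa> i) borel (\<lambda>x'. q x' (snd p))) (q (fst p) (snd p)) < top} \<in> sets (\<mu> \<Otimes>\<^sub>M lborel)"
      by (simp add: sets_eq_imp_space_eq[OF eqM, symmetric])
    \<comment> \<open>So far the exceptional set of parameters depends on \<open>x\<close>; Fubini's
      theorem makes the points exceptional instead.\<close>
    from AE_commute[OF this]
    have "AE u in lborel. AE x in \<mu>. x \<in> A i \<longrightarrow> u \<in> \<Lambda> \<longrightarrow>
        lower_dens (distr (\<kappa> i) borel (\<lambda>x'. q x' u)) (q x u) < top"
      using x by auto
    then show ?thesis
      by eventually_elim (auto simp: G_def)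
  qed
  then have "AE u in lborel. \<forall>i\<in>I. u \<in> \<Lambda> \<longrightarrow> (AE x in \<mu>. x \<in> A i \<longrightarrow> q x u \<in> G u i)"
    unfolding AE_ball_countable[OF I(1)] by blast
  with sing show ?thesis
  proof eventually_elim
    case (elim u)
    show ?case
    proof
      assume u: "u \<in> S"
      then have "u \<in> \<Lambda>" using S by blast
      have "\<exists>B\<in>sets \<mu>. emeasure \<mu> (space \<mu> - B) = 0 \<and> inj_on (\<lambda>x. q x u) B"
      proof (rule AE_inj_on_full_set[OF I(1), where A=A and C=C and G="G u"])
        show "\<exists>i\<in>I. x \<in> A i \<and> x' \<in> C i" if "x \<noteq> x'" for x x'
          using I(2)[OF that] by (force simp: A_def C_def)
        show "AE x in \<mu>. x \<in> A i \<longrightarrow> q x u \<in> G u i" if "i \<in> I" for i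
          using elim(2) that \<open>u \<in> \<Lambda>\<close> by blast
        show "AE x in \<mu>. x \<in> C i \<longrightarrow> q x u \<notin> G u i" if "i \<in> I" for i
          using AE_lower_dens_restrict_infinite[OF \<mu> measurable_section[OF q] Cb(2)] elim(1) u
          by (simp add: G_def \<kappa>_def not_less top_unique)
      qed
      then show "\<exists>B\<in>sets \<mu>. emeasure \<mu> (space \<mu> - B) = 0 \<and> inj_on (\<lambda>x. P x u) B"
        using qP[OF \<open>u \<in> \<Lambda>\<close>] by simp
    qed
  qed
qed

text \<open>Needed for the set of parameters with nonzero absolutely continuous part to be Borel.
  Pulled back along \<open>q\<close>, the mass becomes the measure of sections of one fixed
  measurable set.\<close>

lemma measurable_emeasure_finite_lower_dens:
  fixes q :: "'x::topological_space \<Rightarrow> 'b::topological_space \<Rightarrow> 'a::euclidean_space"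
  assumes q: "(\<lambda>p. q (fst p) (snd p)) \<in> borel_measurable (borel \<Otimes>\<^sub>M borel)"
    and \<mu>: "finite_measure \<mu>" "sets \<mu> = sets borel"
  shows "(\<lambda>u. emeasure (distr \<mu> borel (\<lambda>x. q x u))
    {y. lower_dens (distr \<mu> borel (\<lambda>x. q x u)) y < top}) \<in> borel_measurable borel"
proof -
  interpret finite_measure \<mu> by fact
  have sp: "space \<mu> = UNIV" using sets_eq_imp_space_eq[OF \<mu>(2)] by simp
  have qm: "(\<lambda>x. q x u) \<in> borel_measurable \<mu>" for u
    using measurable_section[OF q] measurable_cong_sets[OF \<mu>(2) refl] by blast
  let ?h = "\<lambda>p. lower_dens (distr \<mu> borel (\<lambda>x'. q x' (snd p))) (q (fst p) (snd p))"
  let ?M = "borel \<Otimes>\<^sub>M borel :: ('b \<times> 'x) measure"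
  have "(\<lambda>p. (snd p, fst p)) \<in> measurable ?M (borel \<Otimes>\<^sub>M borel)" by measurable
  from measurable_compose[OF this measurable_lower_dens_distr[OF q \<mu>]]
  have [measurable]: "(\<lambda>p. lower_dens (distr \<mu> borel (\<lambda>x'. q x' (fst p))) (q (snd p) (fst p))) \<in> borel_measurable ?M"
    by simp
  have "{p \<in> space ?M. lower_dens (distr \<mu> borel (\<lambda>x'. q x' (fst p))) (q (snd p) (fst p)) < top} \<in> sets ?M"
    by measurable
  then have "{p. lower_dens (distr \<mu> borel (\<lambda>x'. q x' (fst p))) (q (snd p) (fst p)) < top} \<in> sets (borel \<Otimes>\<^sub>M \<mu>)"
    using sets_pair_measure_cong[OF refl \<mu>(2), of "borel :: 'b measure"] by (simp add: space_pair_measure)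
  from measurable_emeasure_Pair[OF this]
  have "(\<lambda>u. emeasure \<mu> {x. lower_dens (distr \<mu> borel (\<lambda>x'. q x' u)) (q x u) < top}) \<in> borel_measurable borel"
    by (simp add: vimage_def)
  moreover have "emeasure (distr \<mu> borel (\<lambda>x. q x u)) {y. lower_dens (distr \<mu> borel (\<lambda>x. q x u)) y < top}
      = emeasure \<mu> {x. lower_dens (distr \<mu> borel (\<lambda>x'. q x' u)) (q x u) < top}" for u
  proof (subst emeasure_distr[OF qm])
    have "lower_dens (distr \<mu> borel (\<lambda>x. q x u)) \<in> borel_measurable borel"
      using qm by (intro borel_measurable_lower_dens finite_measure_distr) auto
    then show "{y. lower_dens (distr \<mu> borel (\<lambda>x. q x u)) y < top} \<in> sets borel" by measurable
  qed (simp add: sp vimage_def)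
  ultimately show ?thesis by simp
qed

theorem theorem3p4:
  fixes \<Lambda> S :: "(real ^ 'l) set"
    and P :: "'x::metric_space \<Rightarrow> real ^ 'l \<Rightarrow> real ^ 'm"
    and \<mu> :: "'x measure"
  assumes "locally_compact_space (euclidean :: 'x topology)"
    and "transversal_family \<Lambda> P"
    and "finite_measure \<mu>" and "sets \<mu> = sets borel"
    and "S \<in> sets borel" and "S \<subseteq> \<Lambda>"
  shows "(AE u in lebesgue. u \<in> S \<longrightarrow>
            (\<exists>A\<in>sets \<mu>. emeasure \<mu> (space \<mu> - A) = 0 \<and> inj_on (\<lambda>x. P x u) A)) \<or>
         emeasure lebesgue
           {u\<in>S. ac_part (hausdorff_measure CARD('m)) (distr \<mu> borel (\<lambda>x. P x u))
                   \<noteq> null_measure borel} > 0"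
proof (cases "\<Lambda> = {}")
  case True
  then show ?thesis using assms(6) by auto
next
  case False
  \<comment> \<open>Separability is obtained from the maps at a single parameter, hence the separate
    treatment of empty \<open>\<Lambda>\<close>.\<close>
  then obtain u0 where "u0 \<in> \<Lambda>" by blast
  then obtain D :: "'x set" where D: "countable D" "\<forall>x. \<forall>e>0. \<exists>d\<in>D. dist d x < e"
    using transversal_family_separable[OF assms(2)] by metis
  have \<Lambda>: "open \<Lambda>" "continuous_on (UNIV \<times> \<Lambda>) (\<lambda>(x, u). P x u)"
    using assms(2) by (simp_all add: transversal_family_def)
  \<comment> \<open>\<open>P\<close> is constrained over \<open>\<Lambda>\<close> only;
    \<open>q\<close> is measurable for all parameters.\<close>
  define q where "q x u = (if u \<in> \<Lambda> then P x u else 0)" for x u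
  have q: "(\<lambda>p. q (fst p) (snd p)) \<in> borel_measurable (borel \<Otimes>\<^sub>M borel)"
    using measurable_continuous_on_pair_borel[OF D \<Lambda>] by (simp add: q_def split_beta cong: if_cong)
  have qP: "q x u = P x u" if "u \<in> \<Lambda>" for x u using that by (simp add: q_def)
  define H where "H u = emeasure (distr \<mu> borel (\<lambda>x. q x u))
    {y. lower_dens (distr \<mu> borel (\<lambda>x. q x u)) y < top}" for u
  define Z where "Z = {u \<in> S. H u \<noteq> 0}"
  have qm: "(\<lambda>x. q x u) \<in> borel_measurable \<mu>" for u
    using measurable_section[OF q] measurable_cong_sets[OF assms(4) refl] by blast
  have Z: "{u\<in>S. ac_part (hausdorff_measure CARD('m)) (distr \<mu> borel (\<lambda>x. P x u)) \<noteq> null_measure borel} = Z"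
  proof -
    have "ac_part (hausdorff_measure CARD('m)) (distr \<mu> borel (\<lambda>x. P x u)) \<noteq> null_measure borel
        \<longleftrightarrow> H u \<noteq> 0" if "u \<in> S" for u
    proof -
      have "u \<in> \<Lambda>" using that assms(6) by blast
      have "finite_measure (distr \<mu> borel (\<lambda>x. q x u))"
        by (rule finite_measure.finite_measure_distr[OF assms(3) qm])
      from ac_part_hausdorff_nonzero_iff[OF this]
      have "ac_part (hausdorff_measure CARD('m)) (distr \<mu> borel (\<lambda>x. q x u)) \<noteq> null_measure borel
          \<longleftrightarrow> H u \<noteq> 0" by (simp add: H_def)
      then show ?thesis by (simp add: qP[OF \<open>u \<in> \<Lambda>\<close>])
    qed
    then show ?thesis by (auto simp: Z_def)
  qed
  have [measurable]: "H \<in> borel_measurable borel"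
    unfolding H_def[abs_def] by (rule measurable_emeasure_finite_lower_dens[OF q assms(3,4)])
  note [measurable] = assms(5)
  have Zb: "Z \<in> sets borel" unfolding Z_def by measurable
  show ?thesis
  proof (cases "emeasure lborel Z = 0")
    case True
    then have "Z \<in> null_sets lborel" using Zb by (simp add: null_sets_def)
    then have "AE u in lborel. u \<notin> Z" by (rule AE_not_in)
    then have sing: "AE u in lborel. u \<in> S \<longrightarrow> H u = 0"
      by eventually_elim (auto simp: Z_def)
    then have "AE u in lborel. u \<in> S \<longrightarrow>
        (\<exists>A\<in>sets \<mu>. emeasure \<mu> (space \<mu> - A) = 0 \<and> inj_on (\<lambda>x. P x u) A)"
      by (intro AE_transversal_inj_on[OF assms(2) q qP D assms(3,4,6) sing[unfolded H_def]])
    then show ?thesis by (intro disjI1 AE_completion)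
  next
    case False
    then show ?thesis using Zb by (simp add: Z zero_less_iff_neq_zero)
  qed
qed

end
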